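(* Let $1\le k\le n+1$, let $\mathcal G$ be any set with $\mathcal P_+^{k:n}\cup\mathcal P^+_{0:n}\subseteq\mathcal G\subseteq\mathcal F_+^{k:n}$, and take any $(\nu_1,\nu_2)\in\mathrm N_+(\mathcal G)\times\mathrm N_+(\mathcal G)$. Then $(\nu_1,\nu_2)\in\hat{\mathcal G}$ if and only if all of the following conditions hold: (i) $\nu_1(p)=\nu_2(p)\in\mathbb R$ for all $p\in\mathcal P^{\le k-1}$; (ii) $\nu_1(p)\ge\nu_2(p)$ for all $p\in\mathcal P_+^{k:n}$; (iii) $\nu_1(p_{t;0,n}^+)\ge\nu_2(p_{t;0,n}^+)$ for all $t\in I$.
   Context: Indices $i,j,k,m,n$ are nonnegative integers. $I\subseteq\mathbb R$ is an interval of nonzero length, $a=\inf I$, $b=\sup I$ ($-\infty\le a<b\le\infty$). $\mathcal B$ is the set of Borel-measurable functions $I\to\mathbb R$; $\mathcal B^+=\{w\in\mathcal B: w>0\}$. $\mathcal{RC}$ is the set of functions $I\to\mathbb R$ that are right-continuous on $I\setminus\{b\}$ and, if $b\in I$, left-continuous at $b$. For $w\in\mathcal B^+$, $\mathcal{RC}_w=\{f\in\mathcal B: f/w\in\mathcal{RC}\}$, and $\mathcal S_w$ is the set of $f\in\mathcal B$ for which there is a function $D_wf\in\mathcal{RC}_w$ (necessarily unique) with $f(x)=f(z)+\int_z^x(D_wf)(u)\,du$ for all $x,z\in I$ (with $\int_z^x=-\int_x^z$ if $x<z$). Fix a sequence $\mathbf w=(w_0,w_1,\dots)$ of gauge functions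 in $\mathcal B^+$, each bounded on every compact subset of $I$. Put $\mathcal S^0=\mathcal B$, $f^{(0)}=f/w_0$, and recursively for $j\ge1$: $\mathcal S^j=\{f\in\mathcal S^{j-1}: f^{(j-1)}\in\mathcal S_{w_j}\}$ and $f^{(j)}=(D_{w_j}f^{(j-1)})/w_j$ for $f\in\mathcal S^j$. For integers $j\ge-1$, $\mathcal P^{\le j}=\{p\in\mathcal S^{j+1}: p^{(j+1)}=0\}$ ($\mathbf w$-polynomials of degree $\le j$). $\mathcal F_+^{k:n}$ is the set of $f\in\mathcal S^n$ such that $f^{(j)}$ is nondecreasing on $I$ for each $j\in\{k-1,\dots,n\}$. $\mathcal P_+^{k:n}=\mathcal P^{\le n}\cap\mathcal F_+^{k:n}$. For $t\in I$ and $j\le m$ define $p_{t;j,m}:I\to\mathbb R$ by $p_{t;m,m}=w_m$ and $p_{t;j,m}(x)=w_j(x)\int_{t}^{x}p_{t;j+1,m}(u)\,du$ for $j<m$; put $p_{t;j,m}^+(x)=p_{t;j,m}(x)$ if $x\ge t$ and $0$ if $x<t$. $\mathcal P^+_{0:n}=\{p_{t;0,n}^+: t\in I\}$. $\mathrm N_+$ is the set of all nonnegative (not necessarily finite) measures on the Borel $\sigma$-algebra over $I$. For Borel $f$ and $\nu\in\mathrm N_+$, $\nu(f)=\int_I f\,d\nu=\nu(f_+)-\nu(f_-)$, which exists if at least one of $\nu(f_+),\nu(f_-)$ is finite; any stated condition on $\nu(f)$ means that $\nu(f)$ exists (in $[-\infty,\infty]$) and satisfies the condition. $\mathrm N_+(\mathcal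 G)=\{\nu\in\mathrm N_+:\nu(f)>-\infty\text{ for all }f\in\mathcal G\}$. The dual cone is $\hat{\mathcal G}=\{(\nu_1,\nu_2)\in\mathrm N_+(\mathcal G)\times\mathrm N_+(\mathcal G):\nu_1(f)\ge\nu_2(f)\text{ for all }f\in\mathcal G\}$. *)

theory Defs
  imports "HOL-Analysis.Analysis"
begin

text \<open>Functions from the interval \<open>I\<close> to the reals are represented by the elements of
  \<open>extensional I\<close>, so that equality of representatives is equality on \<open>I\<close>.\<close>

definition borel_on :: "real set \<Rightarrow> (real \<Rightarrow> real) set" where
  "borel_on I = extensional I \<inter> borel_measurable (restrict_space borel I)"

definition borel_pos_on :: "real set \<Rightarrow> (real \<Rightarrow> real) set" where
  "borel_pos_on I = {w \<in> borel_on I. \<forall>x\<in>I. w x > 0}"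

definition gauge_sequence :: "real set \<Rightarrow> (nat \<Rightarrow> real \<Rightarrow> real) \<Rightarrow> bool" where
  "gauge_sequence I w \<longleftrightarrow>
     (\<forall>j. w j \<in> borel_pos_on I \<and> (\<forall>K. compact K \<and> K \<subseteq> I \<longrightarrow> bounded (w j ` K)))"

definition RC :: "real set \<Rightarrow> (real \<Rightarrow> real) set" where
  "RC I = {f \<in> extensional I. \<forall>x\<in>I.
     if ereal x = Sup (ereal ` I) then continuous (at_left x) f else continuous (at_right x) f}"

definition RC_gauge :: "real set \<Rightarrow> (real \<Rightarrow> real) \<Rightarrow> (real \<Rightarrow> real) set" where
  "RC_gauge I w = {f \<in> borel_on I. (\<lambda>x\<in>I. f x / w x) \<in> RC I}"

text \<open>Integrability is stated explicitly: a right-continuous function can be unbounded to the left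
  of a point, and the library integral of a non-integrable function is 0. For \<open>x < z\<close> the interval
  integral is the negative of the integral from \<open>x\<close> to \<open>z\<close>.\<close>

definition is_gauge_deriv ::
    "real set \<Rightarrow> (real \<Rightarrow> real) \<Rightarrow> (real \<Rightarrow> real) \<Rightarrow> (real \<Rightarrow> real) \<Rightarrow> bool" where
  "is_gauge_deriv I w f g \<longleftrightarrow> g \<in> RC_gauge I w \<and>
     (\<forall>x\<in>I. \<forall>z\<in>I. interval_lebesgue_integrable lborel (ereal z) (ereal x) g \<and>
        f x = f z + (LBINT u=ereal z..ereal x. g u))"

definition S_gauge :: "real set \<Rightarrow> (real \<Rightarrow> real) \<Rightarrow> (real \<Rightarrow> real) set" where
  "S_gauge I w = {f \<in> borel_on I. \<exists>g. is_gauge_deriv I w f g}"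

text \<open>Uniqueness of the derivative: two candidates agree almost everywhere on \<open>I\<close>, hence everywhere
  by the one-sided continuity of their quotients by \<open>w\<close>.\<close>

definition D_gauge :: "real set \<Rightarrow> (real \<Rightarrow> real) \<Rightarrow> (real \<Rightarrow> real) \<Rightarrow> real \<Rightarrow> real" where
  "D_gauge I w f = (THE g. is_gauge_deriv I w f g)"

primrec wderiv :: "real set \<Rightarrow> (nat \<Rightarrow> real \<Rightarrow> real) \<Rightarrow> nat \<Rightarrow> (real \<Rightarrow> real) \<Rightarrow> real \<Rightarrow> real" where
  "wderiv I w 0 f = (\<lambda>x\<in>I. f x / w 0 x)"
| "wderiv I w (Suc j) f = (\<lambda>x\<in>I. D_gauge I (w (Suc j)) (wderiv I w j f) x / w (Suc j) x)"

primrec S_space :: "real set \<Rightarrow> (nat \<Rightarrow> real \<Rightarrow> real) \<Rightarrow> nat \<Rightarrow> (real \<Rightarrow> real) set" where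
  "S_space I w 0 = borel_on I"
| "S_space I w (Suc j) = {f \<in> S_space I w j. wderiv I w j f \<in> S_gauge I (w (Suc j))}"

text \<open>Degree bounds are natural numbers: the zero space of degree at most \<open>-1\<close> is not covered.\<close>

definition wpoly :: "real set \<Rightarrow> (nat \<Rightarrow> real \<Rightarrow> real) \<Rightarrow> nat \<Rightarrow> (real \<Rightarrow> real) set" where
  "wpoly I w j = {p \<in> S_space I w (Suc j). \<forall>x\<in>I. wderiv I w (Suc j) p x = 0}"

text \<open>Meant for \<open>k \<ge> 1\<close>, where the subtraction is exact.\<close>

definition F_plus :: "real set \<Rightarrow> (nat \<Rightarrow> real \<Rightarrow> real) \<Rightarrow> nat \<Rightarrow> nat \<Rightarrow> (real \<Rightarrow> real) set" where
  "F_plus I w k n = {f \<in> S_space I w n. \<forall>j\<in>{k - 1..n}. mono_on I (wderiv I w j f)}"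

definition P_plus :: "real set \<Rightarrow> (nat \<Rightarrow> real \<Rightarrow> real) \<Rightarrow> nat \<Rightarrow> nat \<Rightarrow> (real \<Rightarrow> real) set" where
  "P_plus I w k n = wpoly I w n \<inter> F_plus I w k n"

text \<open>The functions \<open>p\<^bsub>t;j,m\<^esub>\<close>, meant for \<open>j \<le> m\<close>.\<close>

function pbasis ::
    "real set \<Rightarrow> (nat \<Rightarrow> real \<Rightarrow> real) \<Rightarrow> real \<Rightarrow> nat \<Rightarrow> nat \<Rightarrow> real \<Rightarrow> real" where
  "pbasis I w t j m =
     (if j < m
      then (\<lambda>x\<in>I. w j x * (LBINT u=ereal t..ereal x. pbasis I w t (Suc j) m u))
      else w m)"
  by pat_completeness auto
termination by (relation "Wellfounded.measure (\<lambda>(I, w, t, j, m). m - j)") auto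

declare pbasis.simps [simp del]

definition pbasis_plus ::
    "real set \<Rightarrow> (nat \<Rightarrow> real \<Rightarrow> real) \<Rightarrow> real \<Rightarrow> nat \<Rightarrow> nat \<Rightarrow> real \<Rightarrow> real" where
  "pbasis_plus I w t j m = (\<lambda>x\<in>I. if t \<le> x then pbasis I w t j m x else 0)"

definition pbasis_plus_set :: "real set \<Rightarrow> (nat \<Rightarrow> real \<Rightarrow> real) \<Rightarrow> nat \<Rightarrow> (real \<Rightarrow> real) set" where
  "pbasis_plus_set I w n = {pbasis_plus I w t 0 n | t. t \<in> I}"

definition measures_on :: "real set \<Rightarrow> real measure set" where
  "measures_on I = {\<nu>. sets \<nu> = sets (restrict_space borel I)}"

text \<open>The coercion \<open>ennreal\<close> sends negative reals to 0, so the two nonnegative integrals below are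
  those of the positive and the negative part of \<open>f\<close>. The value of \<open>ext_integral\<close> is meaningful
  only if \<open>has_ext_integral\<close> holds.\<close>

definition has_ext_integral :: "real measure \<Rightarrow> (real \<Rightarrow> real) \<Rightarrow> bool" where
  "has_ext_integral \<nu> f \<longleftrightarrow>
     (\<integral>\<^sup>+x. ennreal (f x) \<partial>\<nu>) < \<infinity> \<or> (\<integral>\<^sup>+x. ennreal (- f x) \<partial>\<nu>) < \<infinity>"

definition ext_integral :: "real measure \<Rightarrow> (real \<Rightarrow> real) \<Rightarrow> ereal" where
  "ext_integral \<nu> f =
     enn2ereal (\<integral>\<^sup>+x. ennreal (f x) \<partial>\<nu>) - enn2ereal (\<integral>\<^sup>+x. ennreal (- f x) \<partial>\<nu>)"

definition ext_integral_ge :: "real measure \<Rightarrow> real measure \<Rightarrow> (real \<Rightarrow> real) \<Rightarrow> bool" where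
  "ext_integral_ge \<nu>1 \<nu>2 f \<longleftrightarrow> has_ext_integral \<nu>1 f \<and> has_ext_integral \<nu>2 f \<and>
     ext_integral \<nu>1 f \<ge> ext_integral \<nu>2 f"

definition measures_bounded_below :: "real set \<Rightarrow> (real \<Rightarrow> real) set \<Rightarrow> real measure set" where
  "measures_bounded_below I G =
     {\<nu> \<in> measures_on I. \<forall>f\<in>G. has_ext_integral \<nu> f \<and> ext_integral \<nu> f > -\<infinity>}"

definition dual_cone :: "real set \<Rightarrow> (real \<Rightarrow> real) set \<Rightarrow> (real measure \<times> real measure) set" where
  "dual_cone I G = {(\<nu>1, \<nu>2) \<in> measures_bounded_below I G \<times> measures_bounded_below I G.
     \<forall>f\<in>G. ext_integral_ge \<nu>1 \<nu>2 f}"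

end

theory Submission
  imports Defs
begin

text \<open>Write \<open>f\<^sub>j\<close> for the \<open>j\<close>-th derivative of \<open>f\<close>. The substance is in deriving the
  inequality on the whole cone from (i), (ii), (iii). For \<open>f\<close> in the cone and \<open>j \<ge> k\<close> the
  derivative \<open>f\<^sub>j\<close> is nonnegative and nondecreasing, so it has a finite limit at the left end
  \<open>a\<close>. The top derivative is an increasing limit of nonnegative nondecreasing step functions.
  Integrating these from \<open>a\<close> with initial values \<open>f\<^sub>j(a+)\<close> down to level \<open>k\<close> keeps the
  convergence monotone and produces sums of a polynomial with nonnegative derivatives and a
  nonnegative combination of truncated functions. (Taylor polynomials at an interior point would
  not do: their derivatives can be negative to the left of the point.) Below level \<open>k\<close> one
  integrates from a fixed \<open>c\<close>. This removes a Taylor polynomial of degree at most \<open>k - 1\<close>, on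
  which both measures agree by (i), and leaves a remainder of constant sign on either side of
  \<open>c\<close>. (For \<open>k = n + 1\<close> the step functions approximate \<open>f\<^sub>n - f\<^sub>n(c)\<close> directly.) The positive and
  negative parts of the approximants increase to those of the remainder, so (ii) and (iii) pass to
  the limit by monotone convergence.\<close>

section \<open>Primitives on an interval\<close>

text \<open>Integrals over the cone may be \<open>\<infinity>\<close>, so no integrable bound is at
  hand, and every approximant has to move away from zero at every point. This dictates the rounding
  toward zero at the top level and the sign \<open>\<sigma>\<close>: each integration from c
  reverses signs to the left of c, for approximants and remainder alike. A second constraint is that
  the polynomial part of an approximant must lie in the cone. Every combination of truncated
  functions vanishes up to some point of I; there the approximant coincides with its polynomial
  part, which is how the latter inherits nonnegativity. The top entry carried for a truncated
  function is the indicator of a ray, which may be open or consist of b alone and then lacks the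
  one-sided continuity of a derivative. Approximants are therefore families linked by primitives,
  and only their polynomial parts, whose entries are continuous, are identified with gauge
  derivatives.\<close>

definition primitive :: "real set \<Rightarrow> (real \<Rightarrow> real) \<Rightarrow> (real \<Rightarrow> real) \<Rightarrow> bool" where
  "primitive I d v \<longleftrightarrow> (\<forall>x\<in>I. \<forall>z\<in>I. z \<le> x \<longrightarrow>
     set_integrable lborel {z..x} d \<and> v x - v z = (LINT s:{z..x}|lborel. d s))"

locale nondegenerate_interval =
  fixes I :: "real set"
  assumes interval: "is_interval I" and nondeg: "\<exists>x\<in>I. \<exists>y\<in>I. x < y"
begin

lemma atLeastAtMost_subset: "x \<in> I \<Longrightarrow> y \<in> I \<Longrightarrow> {x..y} \<subseteq> I"
  using interval unfolding is_interval_1 by (meson atLeastAtMost_iff subsetI)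

lemma borel_interval [measurable]: "I \<in> sets borel"
  using interval by (rule real_interval_borel_measurable)

lemma primitive_integrable: "primitive I d v \<Longrightarrow> x \<in> I \<Longrightarrow> z \<in> I \<Longrightarrow> set_integrable lborel {z..x} d"
  unfolding primitive_def by (cases "z \<le> x") (auto simp: set_integrable_def)

lemma primitive_eq:
  "primitive I d v \<Longrightarrow> x \<in> I \<Longrightarrow> z \<in> I \<Longrightarrow> z \<le> x \<Longrightarrow> v x - v z = (LINT s:{z..x}|lborel. d s)"
  unfolding primitive_def by blast

lemma primitive_cong:
  assumes "primitive I d v" "\<And>x. x \<in> I \<Longrightarrow> d x = d' x" "\<And>x. x \<in> I \<Longrightarrow> v x = v' x"
  shows "primitive I d' v'"
  unfolding primitive_def
proof (intro ballI impI)
  fix x z assume xz: "x \<in> I" "z \<in> I" "z \<le> x"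
  have eq: "s \<in> {z..x} \<Longrightarrow> d s = d' s" for s
    using assms(2)[of s] subsetD[OF atLeastAtMost_subset[OF xz(2,1)], of s] by simp
  have "set_integrable lborel {z..x} d'"
    using assms(1) xz eq set_integrable_cong[of lborel lborel "{z..x}" "{z..x}" d d']
    unfolding primitive_def by blast
  moreover have "(LINT s:{z..x}|lborel. d s) = (LINT s:{z..x}|lborel. d' s)"
    by (rule set_lebesgue_integral_cong) (use eq in auto)
  ultimately show "set_integrable lborel {z..x} d' \<and> v' x - v' z = (LINT s:{z..x}|lborel. d' s)"
    using assms(1,3) xz unfolding primitive_def by metis
qed

lemma primitive_add:
  assumes "primitive I d v" "primitive I d' v'"
  shows "primitive I (\<lambda>x. d x + d' x) (\<lambda>x. v x + v' x)"
  unfolding primitive_def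
proof (intro ballI impI)
  fix x z assume xz: "x \<in> I" "z \<in> I" "z \<le> x"
  note * = primitive_integrable[OF assms(1) xz(1,2)] primitive_integrable[OF assms(2) xz(1,2)]
    primitive_eq[OF assms(1) xz] primitive_eq[OF assms(2) xz]
  show "set_integrable lborel {z..x} (\<lambda>x. d x + d' x) \<and>
      v x + v' x - (v z + v' z) = (LINT s:{z..x}|lborel. d s + d' s)"
    using * by (simp add: set_integral_add)
qed

lemma primitive_scale:
  assumes "primitive I d v"
  shows "primitive I (\<lambda>x. c * d x) (\<lambda>x. c * v x)"
  using assms unfolding primitive_def by (auto simp flip: right_diff_distrib)

lemma primitive_diff:
  assumes "primitive I d v" "primitive I d' v'"
  shows "primitive I (\<lambda>x. d x - d' x) (\<lambda>x. v x - v' x)"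
  using primitive_add[OF assms(1) primitive_scale[OF assms(2), of "-1"]] by simp

lemma primitive_const: "primitive I (\<lambda>_. 0) (\<lambda>_. c)"
  unfolding primitive_def by (auto simp: set_integrable_def)

lemma primitive_mono:
  assumes "primitive I d v" "\<And>x. x \<in> I \<Longrightarrow> d x \<ge> 0"
  shows "mono_on I v"
proof (rule mono_onI)
  fix z x assume xz: "z \<in> I" "x \<in> I" "z \<le> x"
  have "(LINT s:{z..x}|lborel. d s) \<ge> 0"
    unfolding set_lebesgue_integral_def
    by (rule Bochner_Integration.integral_nonneg)
      (use assms(2) atLeastAtMost_subset[OF xz(1,2)] in \<open>auto simp: indicator_def\<close>)
  then show "v z \<le> v x" using primitive_eq[OF assms(1) xz(2,1,3)] by linarith
qed

text \<open>Continuity at a point is tested on an interval \<open>{z..y}\<close> that is a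
  neighbourhood of it relative to I. At an end point belonging to I this interval lies on one side,
  so \<open>L\<close> and \<open>R\<close> record on which sides I continues.\<close>

lemma continuous_on_interval:
  fixes v :: "real \<Rightarrow> real"
  assumes "\<And>z y. z \<in> I \<Longrightarrow> y \<in> I \<Longrightarrow> z < y \<Longrightarrow> continuous_on {z..y} v"
  shows "continuous_on I v"
  unfolding continuous_on_eq_continuous_within
proof
  fix x assume x: "x \<in> I"
  define L where "L = (\<exists>z\<in>I. z < x)"
  define R where "R = (\<exists>y\<in>I. x < y)"
  obtain z where z: "z \<in> I" "z \<le> x" "L \<Longrightarrow> z < x" using x unfolding L_def by (metis order.order_iff_strict)
  obtain y where y: "y \<in> I" "x \<le> y" "R \<Longrightarrow> x < y" using x unfolding R_def by (metis order.order_iff_strict)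
  define A where "A = (if L then {z<..} else UNIV) \<inter> (if R then {..<y} else UNIV)"
  have "open A" "x \<in> A" using z y unfolding A_def by auto
  have sub: "I \<inter> A \<subseteq> {z..y}" using z y unfolding A_def L_def R_def
    by (auto split: if_splits simp: not_less) (meson order_trans)+
  have eq: "at x within I = at x within {z..y}"
    by (rule at_within_nhd[OF \<open>x \<in> A\<close> \<open>open A\<close>])
      (use sub atLeastAtMost_subset[OF z(1) y(1)] in auto)
  obtain p q where "p \<in> I" "q \<in> I" "p < q" using nondeg by blast
  then have "L \<or> R" unfolding L_def R_def by (metis not_less order_less_le_trans)
  then have "z < y" using z y by auto
  then have "continuous_on {z..y} v" by (rule assms[OF z(1) y(1)])
  then show "continuous (at x within I) v"
    using z y unfolding eq continuous_on_eq_continuous_within by auto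
qed

lemma primitive_continuous:
  assumes "primitive I d v"
  shows "continuous_on I v"
proof (rule continuous_on_interval)
  fix z y assume zy: "z \<in> I" "y \<in> I" "z < y"
  have "set_integrable lborel {z..y} d" using primitive_integrable[OF assms] zy by blast
  then have "d integrable_on {z..y}" by (rule set_borel_integral_eq_integral(1))
  then have c: "continuous_on {z..y} (\<lambda>x. v z + integral {z..x} d)"
    by (intro continuous_intros indefinite_integral_continuous_1)
  have "v x = v z + integral {z..x} d" if "x \<in> {z..y}" for x
  proof -
    have "x \<in> I" using atLeastAtMost_subset[OF zy(1,2)] that by blast
    then have *: "set_integrable lborel {z..x} d" "v x - v z = (LINT s:{z..x}|lborel. d s)"
      using primitive_integrable[OF assms _ zy(1), of x] primitive_eq[OF assms _ zy(1), of x] that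
      by simp_all
    show ?thesis using set_borel_integral_eq_integral(2)[OF *(1)] *(2) by simp
  qed
  then show "continuous_on {z..y} v" using c by (metis (no_types, lifting) continuous_on_cong)
qed

lemma sup_interval:
  assumes "x \<in> I"
  shows "ereal x = Sup (ereal ` I) \<longleftrightarrow> (\<forall>y\<in>I. y \<le> x)"
proof
  assume "ereal x = Sup (ereal ` I)"
  then have "ereal y \<le> ereal x" if "y \<in> I" for y
    using Sup_upper[of "ereal y" "ereal ` I"] that by simp
  then show "\<forall>y\<in>I. y \<le> x" by simp
next
  assume "\<forall>y\<in>I. y \<le> x"
  then show "ereal x = Sup (ereal ` I)"
    using assms by (intro Sup_eqI[symmetric]) auto
qed

lemma continuous_RC:
  assumes "continuous_on I v"
  shows "restrict v I \<in> RC I"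
  unfolding RC_def
proof (intro CollectI conjI ballI)
  fix x assume x: "x \<in> I"
  have "continuous_on I (restrict v I)"
    using assms continuous_on_cong[OF refl, of I "restrict v I" v] by simp
  then have c: "continuous (at x within I) (restrict v I)"
    unfolding continuous_on_eq_continuous_within using x by (rule bspec)
  show "if ereal x = Sup (ereal ` I) then continuous (at_left x) (restrict v I)
    else continuous (at_right x) (restrict v I)"
  proof (cases "ereal x = Sup (ereal ` I)")
    case True
    then obtain y where "y \<in> I" "y < x" using nondeg sup_interval[OF x] by (meson order_less_le_trans)
    then show ?thesis
      using True continuous_within_subset[OF c atLeastAtMost_subset[OF _ x]] at_within_Icc_at_left
      by fastforce
  next
    case False
    then obtain y where "y \<in> I" "x < y" using sup_interval[OF x] by force
    then show ?thesis
      using False continuous_within_subset[OF c atLeastAtMost_subset[OF x]] at_within_Icc_at_right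
      by fastforce
  qed
qed simp

text \<open>A nonnegative integrand with zero integral vanishes almost everywhere, whereas this one
  is positive on an open interval of positive length.\<close>

lemma set_integral_pos_interval:
  fixes g :: "real \<Rightarrow> real"
  assumes "z < y" "set_integrable lborel {z..y} g" "\<And>s. z < s \<Longrightarrow> s < y \<Longrightarrow> g s > 0"
  shows "(LINT s:{z..y}|lborel. g s) > 0"
proof -
  have i: "set_integrable lborel {z<..<y} g"
    using assms(2) by (rule set_integrable_subset) auto
  have eq: "(LINT s:{z..y}|lborel. g s) = (LINT s:{z<..<y}|lborel. g s)"
    by (rule set_integral_discrete_difference[where X="{z, y}"]) auto
  have nn: "0 \<le> indicator {z<..<y} s *\<^sub>R g s" for s
    using assms(3)[of s] by (auto simp: indicator_def)
  have "(LINT s:{z<..<y}|lborel. g s) \<noteq> 0"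
  proof
    assume "(LINT s:{z<..<y}|lborel. g s) = 0"
    then have "AE s in lborel. indicator {z<..<y} s *\<^sub>R g s = 0"
      using integral_nonneg_eq_0_iff_AE[OF i[unfolded set_integrable_def] AE_I2[OF nn]]
      unfolding set_lebesgue_integral_def by simp
    then have "AE s in lborel. s \<notin> {z<..<y}"
      by eventually_elim (auto simp: indicator_def dest: assms(3))
    then have "{z<..<y} \<in> null_sets lborel" by (simp add: AE_iff_null_sets)
    then show False using assms(1) by (simp add: null_sets_def)
  qed
  moreover have "(LINT s:{z<..<y}|lborel. g s) \<ge> 0"
    unfolding set_lebesgue_integral_def using nn by (rule Bochner_Integration.integral_nonneg)
  ultimately show ?thesis using eq by linarith
qed

text \<open>A negative value of \<open>r\<close> persists on a one-sided neighbourhood, over which \<open>g\<close> would have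
  a negative integral.\<close>

lemma one_sided_continuous_nonneg:
  assumes cont: "\<And>x. x \<in> I \<Longrightarrow> if ereal x = Sup (ereal ` I) then continuous (at_left x) r
      else continuous (at_right x) r"
    and w: "\<And>x. x \<in> I \<Longrightarrow> w x > 0" and g: "\<And>x. x \<in> I \<Longrightarrow> g x = w x * r x"
    and "primitive I g v" "mono_on I v" "x \<in> I"
  shows "r x \<ge> (0::real)"
proof (rule ccontr)
  assume "\<not> r x \<ge> 0"
  then have rx: "r x < 0" by simp
  have key: False if "z \<in> I" "y \<in> I" "z < y" and n: "\<And>s. z < s \<Longrightarrow> s < y \<Longrightarrow> r s < 0" for z y
  proof -
    have "s \<in> I" if "z < s" "s < y" for s
      using atLeastAtMost_subset[OF \<open>z \<in> I\<close> \<open>y \<in> I\<close>] that by auto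
    then have "g s < 0" if "z < s" "s < y" for s
      using n[OF that] w[of s] g[of s] that by (simp add: mult_pos_neg)
    moreover have "set_integrable lborel {z..y} (\<lambda>s. - g s)"
      using primitive_integrable[OF assms(4) that(2,1)] by (simp add: set_integrable_def)
    ultimately have "(LINT s:{z..y}|lborel. - g s) > 0"
      using set_integral_pos_interval[OF \<open>z < y\<close>, of "\<lambda>s. - g s"] by simp
    moreover have "(LINT s:{z..y}|lborel. - g s) = - (v y - v z)"
      using primitive_eq[OF assms(4) that(2,1)] that by (simp add: set_lebesgue_integral_def)
    ultimately show False using mono_onD[OF assms(5) that(1,2)] that by simp
  qed
  show False
  proof (cases "ereal x = Sup (ereal ` I)")
    case True
    then have "continuous (at_left x) r" using cont[OF \<open>x \<in> I\<close>] by simp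
    then have "(r \<longlongrightarrow> r x) (at_left x)" by (simp add: continuous_within)
    then have "\<forall>\<^sub>F s in at_left x. r s < 0" using rx by (rule order_tendstoD)
    then obtain b where b: "b < x" "\<And>s. b < s \<Longrightarrow> s < x \<Longrightarrow> r s < 0"
      by (auto simp: eventually_at_left_field)
    obtain y where y: "y \<in> I" "y < x"
      using True nondeg sup_interval[OF \<open>x \<in> I\<close>] by (meson order_less_le_trans)
    show False
      by (rule key[of "max b y" x])
        (use b y \<open>x \<in> I\<close> atLeastAtMost_subset[OF y(1) \<open>x \<in> I\<close>] in auto)
  next
    case False
    then have "continuous (at_right x) r" using cont[OF \<open>x \<in> I\<close>] by simp
    then have "(r \<longlongrightarrow> r x) (at_right x)" by (simp add: continuous_within)
    then have "\<forall>\<^sub>F s in at_right x. r s < 0" using rx by (rule order_tendstoD)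
    then obtain b where b: "b > x" "\<And>s. x < s \<Longrightarrow> s < b \<Longrightarrow> r s < 0"
      by (auto simp: eventually_at_right_field)
    obtain y where y: "y \<in> I" "x < y" using False sup_interval[OF \<open>x \<in> I\<close>] by force
    show False
      by (rule key[of x "min b y"])
        (use b y \<open>x \<in> I\<close> atLeastAtMost_subset[OF \<open>x \<in> I\<close> y(1)] in auto)
  qed
qed

lemma interval_integrable_iff:
  assumes "z \<le> x"
  shows "interval_lebesgue_integrable lborel (ereal z) (ereal x) g \<longleftrightarrow> set_integrable lborel {z..x} g"
proof -
  have "interval_lebesgue_integrable lborel (ereal z) (ereal x) g \<longleftrightarrow> set_integrable lborel {z<..<x} g"
    using assms by (simp add: interval_lebesgue_integrable_def)
  also have "\<dots> \<longleftrightarrow> set_integrable lborel {z..x} g"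
    by (rule set_integrable_discrete_difference[where X="{z, x}"]) auto
  finally show ?thesis .
qed

end

section \<open>Gauge derivatives and polynomials\<close>

locale gauge_interval = nondegenerate_interval +
  fixes w :: "nat \<Rightarrow> real \<Rightarrow> real"
  assumes gauge: "gauge_sequence I w"
begin

abbreviation borel_I :: "real measure" where
  "borel_I \<equiv> restrict_space borel I"

lemma w_pos: "x \<in> I \<Longrightarrow> w j x > 0"
  using gauge unfolding gauge_sequence_def borel_pos_on_def by auto

lemma w_measurable [measurable]: "w j \<in> borel_measurable borel_I"
  using gauge unfolding gauge_sequence_def borel_pos_on_def borel_on_def by auto

lemma borel_measurable_cong_on:
  "f \<in> borel_measurable borel_I \<Longrightarrow> (\<And>x. x \<in> I \<Longrightarrow> f x = g x) \<Longrightarrow> g \<in> borel_measurable borel_I"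
  using measurable_cong[of borel_I f g borel] by (simp add: space_restrict_space)

lemma continuous_borel_measurable: "continuous_on I f \<Longrightarrow> f \<in> borel_measurable borel_I"
  by (rule borel_measurable_continuous_on_restrict)

lemma set_borel_measurable_subset_I:
  fixes f :: "real \<Rightarrow> real"
  assumes "f \<in> borel_measurable borel_I" "A \<in> sets borel" "A \<subseteq> I"
  shows "set_borel_measurable lborel A f"
proof -
  have [measurable]: "(\<lambda>x. indicator I x *\<^sub>R f x) \<in> borel_measurable borel"
    using assms(1) borel_measurable_restrict_space_iff[of I borel f] borel_interval by simp
  have [measurable]: "A \<in> sets borel" by fact
  have "(\<lambda>x. indicator A x *\<^sub>R f x) = (\<lambda>x. indicator A x *\<^sub>R (indicator I x *\<^sub>R f x))"
    using assms(3) by (auto simp: fun_eq_iff indicator_def)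
  moreover have "(\<lambda>x. indicator A x *\<^sub>R (indicator I x *\<^sub>R f x)) \<in> borel_measurable lborel"
    by measurable
  ultimately show ?thesis unfolding set_borel_measurable_def by simp
qed

text \<open>Local boundedness of the gauge functions enters here: it makes the product bounded on
  the compact interval.\<close>

lemma gauge_mult_integrable:
  assumes "u \<in> borel_measurable borel_I" "z \<in> I" "x \<in> I"
    and B: "\<And>s. s \<in> {z..x} \<Longrightarrow> \<bar>u s\<bar> \<le> B"
  shows "set_integrable lborel {z..x} (\<lambda>s. w j s * u s)"
proof -
  note sub = atLeastAtMost_subset[OF assms(2,3)]
  have "bounded (w j ` {z..x})"
    using gauge sub unfolding gauge_sequence_def by simp
  then obtain C where C: "\<And>s. s \<in> {z..x} \<Longrightarrow> \<bar>w j s\<bar> \<le> C"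
    unfolding bounded_iff by (metis imageI real_norm_def)
  have "set_integrable lborel {z..x} (\<lambda>_. C * B)"
    by (rule borel_integrable_atLeastAtMost') simp
  then show ?thesis
  proof (rule set_integrable_bound)
    have "(\<lambda>s. w j s * u s) \<in> borel_measurable borel_I" using assms(1) by measurable
    then show "set_borel_measurable lborel {z..x} (\<lambda>s. w j s * u s)"
      by (rule set_borel_measurable_subset_I) (use sub in auto)
    have "\<bar>w j s * u s\<bar> \<le> \<bar>C * B\<bar>" if "s \<in> {z..x}" for s
    proof -
      have "\<bar>w j s\<bar> * \<bar>u s\<bar> \<le> C * B" using B[OF that] C[OF that] by (intro mult_mono) auto
      then show ?thesis by (simp only: abs_mult[symmetric])
    qed
    then show "AE s in lborel. s \<in> {z..x} \<longrightarrow> norm (w j s * u s) \<le> norm (C * B)"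
      by auto
  qed
qed

lemma gauge_mult_continuous_integrable:
  assumes "continuous_on I u" "z \<in> I" "x \<in> I"
  shows "set_integrable lborel {z..x} (\<lambda>s. w j s * u s)"
proof -
  have "compact (u ` {z..x})"
    using atLeastAtMost_subset[OF assms(2,3)] assms(1)
    by (intro compact_continuous_image) (auto intro: continuous_on_subset)
  then obtain B where "\<forall>y\<in>u ` {z..x}. norm y \<le> B" 
    using compact_imp_bounded[of "u ` {z..x}"] unfolding bounded_iff by blast
  then have "\<bar>u s\<bar> \<le> B" if "s \<in> {z..x}" for s using that by simp
  then show ?thesis
    by (rule gauge_mult_integrable[OF continuous_borel_measurable[OF assms(1)] assms(2,3)])
qed

section \<open>Gauge derivatives in terms of primitives\<close>

lemma is_gauge_deriv_iff:
  "is_gauge_deriv I \<omega> f g \<longleftrightarrow> g \<in> RC_gauge I \<omega> \<and> primitive I g f"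
proof
  assume d: "is_gauge_deriv I \<omega> f g"
  have "set_integrable lborel {z..x} g \<and> f x - f z = (LINT s:{z..x}|lborel. g s)"
    if "x \<in> I" "z \<in> I" "z \<le> x" for x z
  proof -
    have "interval_lebesgue_integrable lborel (ereal z) (ereal x) g"
      "f x = f z + (LBINT u=ereal z..ereal x. g u)"
      using d that unfolding is_gauge_deriv_def by blast+
    then show ?thesis using interval_integrable_iff[OF that(3), of g] interval_integral_Icc[OF that(3), of g]
      by simp
  qed
  then have "primitive I g f" unfolding primitive_def by blast
  then show "g \<in> RC_gauge I \<omega> \<and> primitive I g f"
    using d unfolding is_gauge_deriv_def by blast
next
  assume *: "g \<in> RC_gauge I \<omega> \<and> primitive I g f"
  then have p: "primitive I g f" by simp
  have le: "interval_lebesgue_integrable lborel (ereal z) (ereal x) g \<and>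
      f x = f z + (LBINT u=ereal z..ereal x. g u)" if "x \<in> I" "z \<in> I" "z \<le> x" for x z
    using primitive_eq[OF p that] primitive_integrable[OF p that(1,2)]
      interval_integrable_iff[OF that(3), of g] interval_integral_Icc[OF that(3), of g] by simp
  have "interval_lebesgue_integrable lborel (ereal z) (ereal x) g \<and>
      f x = f z + (LBINT u=ereal z..ereal x. g u)" if "x \<in> I" "z \<in> I" for x z
  proof (cases "z \<le> x")
    case True
    then show ?thesis by (rule le[OF that])
  next
    case False
    then have "interval_lebesgue_integrable lborel (ereal x) (ereal z) g"
      "f z = f x + (LBINT u=ereal x..ereal z. g u)"
      using le[OF that(2,1)] by simp_all
    moreover have "(LBINT u=ereal z..ereal x. g u) = - (LBINT u=ereal x..ereal z. g u)"
      by (rule interval_integral_endpoints_reverse)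
    ultimately show ?thesis
      using interval_integrable_endpoints_reverse[of "ereal z" "ereal x" g] by simp
  qed
  then show "is_gauge_deriv I \<omega> f g" using * unfolding is_gauge_deriv_def by blast
qed

lemma RC_gauge_one_sided:
  assumes "g \<in> RC_gauge I (w j)" "x \<in> I"
  shows "if ereal x = Sup (ereal ` I) then continuous (at_left x) (\<lambda>x\<in>I. g x / w j x)
    else continuous (at_right x) (\<lambda>x\<in>I. g x / w j x)"
  using assms unfolding RC_gauge_def RC_def by blast

text \<open>Two candidates for a derivative differ by a derivative of the zero function. That
  function is nondecreasing, so the difference divided by the gauge is nonnegative. Used in both
  orders, this gives uniqueness.\<close>

lemma RC_gauge_le:
  assumes "g \<in> RC_gauge I (w j)" "g' \<in> RC_gauge I (w j)" "primitive I g f" "primitive I g' f" "x \<in> I"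
  shows "g x \<le> g' x"
proof -
  let ?q = "\<lambda>g. \<lambda>x\<in>I. g x / w j x"
  have "?q g' x - ?q g x \<ge> 0"
  proof (rule one_sided_continuous_nonneg[where w = "w j" and r = "\<lambda>x. ?q g' x - ?q g x"])
    show "if ereal x = Sup (ereal ` I) then continuous (at_left x) (\<lambda>x. ?q g' x - ?q g x)
      else continuous (at_right x) (\<lambda>x. ?q g' x - ?q g x)" if "x \<in> I" for x
      using RC_gauge_one_sided[OF assms(1) that] RC_gauge_one_sided[OF assms(2) that]
      by (cases "ereal x = Sup (ereal ` I)") (simp_all only: if_True if_False continuous_diff simp_thms)
    show "primitive I (\<lambda>x. g' x - g x) (\<lambda>x. f x - f x)" by (rule primitive_diff[OF assms(4,3)])
    show "mono_on I (\<lambda>x. f x - f x)" by (auto intro: mono_onI)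
    show "g' x - g x = w j x * (?q g' x - ?q g x)" if "x \<in> I" for x
      using w_pos[OF that, of j] that by (simp add: field_simps)
  qed (use w_pos assms(5) in auto)
  then show ?thesis using w_pos[OF assms(5), of j] assms(5)
    by (simp add: divide_right_mono_neg field_simps)
qed

lemma D_gauge_eq:
  assumes "is_gauge_deriv I (w j) f g"
  shows "D_gauge I (w j) f = g"
  unfolding D_gauge_def
proof (rule the_equality)
  fix h assume h: "is_gauge_deriv I (w j) f h"
  have "h x = g x" if "x \<in> I" for x
    using RC_gauge_le[of h j g f x] RC_gauge_le[of g j h f x] assms h that
    unfolding is_gauge_deriv_iff by force
  moreover have "h \<in> extensional I" "g \<in> extensional I"
    using assms h unfolding is_gauge_deriv_iff RC_gauge_def borel_on_def by auto
  ultimately show "h = g" by (intro extensionalityI)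
qed (rule assms)

lemma S_space_antimono: "f \<in> S_space I w N \<Longrightarrow> j \<le> N \<Longrightarrow> f \<in> S_space I w j"
  by (induction N) (auto simp: le_Suc_eq)

text \<open>The definite description in \<open>D_gauge\<close> is resolved here; afterwards the
  derivatives of a given function are handled through primitives.\<close>

lemma wderiv_primitive:
  assumes "f \<in> S_space I w N" "j < N"
  shows "primitive I (\<lambda>s. w (Suc j) s * wderiv I w (Suc j) f s) (wderiv I w j f)"
    and "wderiv I w (Suc j) f \<in> RC I"
    and "wderiv I w (Suc j) f \<in> borel_measurable borel_I"
proof -
  have "f \<in> S_space I w (Suc j)" by (rule S_space_antimono[OF assms(1)]) (use assms(2) in simp)
  then obtain g where g: "is_gauge_deriv I (w (Suc j)) (wderiv I w j f) g"
    unfolding S_space.simps S_gauge_def by blast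
  have eq: "wderiv I w (Suc j) f = (\<lambda>x\<in>I. g x / w (Suc j) x)"
    using D_gauge_eq[OF g] by simp
  have gp: "g \<in> RC_gauge I (w (Suc j))" "primitive I g (wderiv I w j f)"
    using g unfolding is_gauge_deriv_iff by auto
  show "primitive I (\<lambda>s. w (Suc j) s * wderiv I w (Suc j) f s) (wderiv I w j f)"
  proof (rule primitive_cong[OF gp(2)])
    show "g x = w (Suc j) x * wderiv I w (Suc j) f x" if "x \<in> I" for x
      using w_pos[OF that, of "Suc j"] that unfolding eq by simp
  qed simp
  show "wderiv I w (Suc j) f \<in> RC I" using gp(1) unfolding eq RC_gauge_def by simp
  have "g \<in> borel_measurable borel_I" using gp(1) unfolding RC_gauge_def borel_on_def by simp
  then have "(\<lambda>x. g x / w (Suc j) x) \<in> borel_measurable borel_I" by measurable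
  then show "wderiv I w (Suc j) f \<in> borel_measurable borel_I"
    unfolding eq by (rule borel_measurable_cong_on) simp
qed

lemma borel_on_measurable: "f \<in> borel_on I \<Longrightarrow> f \<in> borel_measurable borel_I"
  unfolding borel_on_def by simp

lemma wderiv_measurable:
  assumes "f \<in> S_space I w N" "j \<le> N"
  shows "wderiv I w j f \<in> borel_measurable borel_I"
proof (cases j)
  case 0
  have [measurable]: "f \<in> borel_measurable borel_I"
    using S_space_antimono[OF assms(1), of 0] by (simp add: borel_on_measurable)
  have "(\<lambda>x. f x / w 0 x) \<in> borel_measurable borel_I" by measurable
  then show ?thesis unfolding 0 by (rule borel_measurable_cong_on) simp
next
  case (Suc i)
  then show ?thesis using wderiv_primitive(3)[OF assms(1), of i] assms(2) by simp
qed

text \<open>\<open>P i\<close> plays the role of the \<open>i\<close>-th derivative, for \<open>i \<ge> j\<close>; the entries below \<open>j\<close> are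
  arbitrary.\<close>

definition chain_from :: "nat \<Rightarrow> nat \<Rightarrow> (nat \<Rightarrow> real \<Rightarrow> real) \<Rightarrow> bool" where
  "chain_from j N P \<longleftrightarrow>
     (\<forall>i\<ge>j. primitive I (\<lambda>s. w (Suc i) s * P (Suc i) s) (P i)) \<and> (\<forall>i>N. \<forall>x\<in>I. P i x = 0)"

lemma chain_from_primitive:
  "chain_from j N P \<Longrightarrow> j \<le> i \<Longrightarrow> primitive I (\<lambda>s. w (Suc i) s * P (Suc i) s) (P i)"
  unfolding chain_from_def by simp

lemma chain_from_zero: "chain_from j N P \<Longrightarrow> N < i \<Longrightarrow> x \<in> I \<Longrightarrow> P i x = 0"
  unfolding chain_from_def by simp

lemma chain_from_continuous: "chain_from j N P \<Longrightarrow> j \<le> i \<Longrightarrow> continuous_on I (P i)"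
  by (rule primitive_continuous[OF chain_from_primitive])

lemma chain_from_update:
  assumes "chain_from (Suc j) N P" "j \<le> N" "primitive I (\<lambda>s. w (Suc j) s * P (Suc j) s) v"
  shows "chain_from j N (P(j := v))"
  using assms unfolding chain_from_def by auto

text \<open>The inverse of passing to the derivative of order 0.\<close>

definition lift :: "(real \<Rightarrow> real) \<Rightarrow> real \<Rightarrow> real" where
  "lift u = (\<lambda>x\<in>I. w 0 x * u x)"

lemma lift_borel_on:
  assumes "u \<in> borel_measurable borel_I"
  shows "lift u \<in> borel_on I"
proof -
  have "(\<lambda>x. w 0 x * u x) \<in> borel_measurable borel_I" using assms by measurable
  then have "lift u \<in> borel_measurable borel_I"
    by (rule borel_measurable_cong_on) (simp add: lift_def)
  then show ?thesis unfolding borel_on_def by (simp add: lift_def)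
qed

text \<open>Every entry is itself a primitive and hence continuous, so the one-sided continuity
  demanded of a gauge derivative is automatic. \<open>M\<close> may exceed \<open>N\<close>, where
  the entries vanish on I.\<close>

lemma chain_wderiv:
  assumes "chain_from 0 N P"
  shows "lift (P 0) \<in> S_space I w M \<and> (\<forall>j\<le>M. wderiv I w j (lift (P 0)) = restrict (P j) I)"
proof (induction M)
  case 0
  have "wderiv I w 0 (lift (P 0)) = restrict (P 0) I"
  proof
    fix x show "wderiv I w 0 (lift (P 0)) x = restrict (P 0) I x"
      using w_pos[of x 0] by (cases "x \<in> I") (simp_all add: lift_def)
  qed
  then show ?case
    using lift_borel_on[OF continuous_borel_measurable[OF chain_from_continuous[OF assms]]] by simp
next
  case (Suc M)
  let ?f = "lift (P 0)" and ?g = "\<lambda>x\<in>I. w (Suc M) x * P (Suc M) x"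
  have IH: "wderiv I w M ?f = restrict (P M) I" using Suc by blast
  have c: "continuous_on I (P i)" for i using chain_from_continuous[OF assms] by simp
  have eq: "(\<lambda>x\<in>I. ?g x / w (Suc M) x) = restrict (P (Suc M)) I"
  proof
    fix x show "(\<lambda>x\<in>I. ?g x / w (Suc M) x) x = restrict (P (Suc M)) I x"
      using w_pos[of x "Suc M"] by (cases "x \<in> I") simp_all
  qed
  have "(\<lambda>x. w (Suc M) x * P (Suc M) x) \<in> borel_measurable borel_I"
    using continuous_borel_measurable[OF c] by measurable
  then have "?g \<in> borel_measurable borel_I" by (rule borel_measurable_cong_on) simp
  then have "?g \<in> RC_gauge I (w (Suc M))"
    unfolding RC_gauge_def borel_on_def using continuous_RC[OF c] eq by simp
  moreover have "primitive I ?g (restrict (P M) I)"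
    by (rule primitive_cong[OF chain_from_primitive[OF assms]]) simp_all
  ultimately have d: "is_gauge_deriv I (w (Suc M)) (wderiv I w M ?f) ?g"
    unfolding is_gauge_deriv_iff IH by simp
  have "restrict (P M) I \<in> borel_measurable borel_I"
    by (rule borel_measurable_cong_on[OF continuous_borel_measurable[OF c]]) simp
  then have "wderiv I w M ?f \<in> S_gauge I (w (Suc M))"
    using d unfolding S_gauge_def borel_on_def IH by auto
  moreover have "wderiv I w (Suc M) ?f = restrict (P (Suc M)) I"
    using D_gauge_eq[OF d] eq by simp
  ultimately show ?case using Suc by (auto simp: le_Suc_eq)
qed

lemma chain_wpoly:
  assumes "chain_from 0 N P"
  shows "lift (P 0) \<in> wpoly I w N"
proof -
  have S: "lift (P 0) \<in> S_space I w (Suc N)"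
    and "wderiv I w (Suc N) (lift (P 0)) = restrict (P (Suc N)) I"
    using chain_wderiv[OF assms, of "Suc N"] by blast+
  then have "wderiv I w (Suc N) (lift (P 0)) x = 0" if "x \<in> I" for x
    using chain_from_zero[OF assms, of "Suc N" x] that by simp
  then show ?thesis using S unfolding wpoly_def by blast
qed

lemma chain_P_plus:
  assumes "chain_from 0 n P" "1 \<le> k" "\<And>i x. k \<le> i \<Longrightarrow> i \<le> n \<Longrightarrow> x \<in> I \<Longrightarrow> P i x \<ge> 0"
  shows "lift (P 0) \<in> P_plus I w k n"
proof -
  have "mono_on I (wderiv I w j (lift (P 0)))" if j: "j \<in> {k - 1..n}" for j
  proof -
    \<comment> \<open>At \<open>j = n\<close> the next entry is zero on I, so the levels from
      \<open>k - 1\<close> to \<open>n\<close> are all covered.\<close>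
    have "P (Suc j) x \<ge> 0" if "x \<in> I" for x
      using assms(3)[of "Suc j" x] chain_from_zero[OF assms(1), of "Suc j" x] that j \<open>1 \<le> k\<close>
      by (cases "j < n") auto
    then have "mono_on I (P j)"
      by (intro primitive_mono[OF chain_from_primitive[OF assms(1)]])
        (auto intro!: mult_nonneg_nonneg less_imp_le[OF w_pos])
    moreover have "wderiv I w j (lift (P 0)) = restrict (P j) I"
      using chain_wderiv[OF assms(1), of j] by simp
    ultimately show ?thesis by (simp add: monotone_on_def)
  qed
  then show ?thesis
    using chain_wpoly[OF assms(1)] chain_wderiv[OF assms(1), of n]
    unfolding P_plus_def F_plus_def by simp
qed

lemma lift_wderiv_0:
  assumes "f \<in> borel_on I"
  shows "lift (wderiv I w 0 f) = f"
proof (rule extensionalityI)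
  show "f \<in> extensional I" using assms unfolding borel_on_def by simp
  show "lift (wderiv I w 0 f) x = f x" if "x \<in> I" for x
    using w_pos[OF that, of 0] that by (simp add: lift_def)
qed (simp add: lift_def)

lemma wpoly_chain:
  assumes "p \<in> wpoly I w N"
  obtains P where "chain_from 0 N P" "p = lift (P 0)"
proof
  \<comment> \<open>Beyond \<open>N\<close> the zero function replaces the derivatives. On I it
    agrees with the derivative of order \<open>Suc N\<close>, which settles the link between the
    entries \<open>N\<close> and \<open>Suc N\<close>.\<close>
  let ?P = "\<lambda>j. if j \<le> N then wderiv I w j p else (\<lambda>_. 0)"
  have p: "p \<in> S_space I w (Suc N)" and z: "\<And>x. x \<in> I \<Longrightarrow> wderiv I w (Suc N) p x = 0"
    using assms unfolding wpoly_def by blast+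
  have "primitive I (\<lambda>s. w (Suc i) s * ?P (Suc i) s) (?P i)" for i
  proof (cases "i \<le> N")
    case True
    show ?thesis
    proof (rule primitive_cong[OF wderiv_primitive(1)[OF p, of i]])
      show "w (Suc i) x * wderiv I w (Suc i) p x = w (Suc i) x * ?P (Suc i) x" if "x \<in> I" for x
        using z[OF that] True by (cases "i = N") (simp_all del: wderiv.simps)
    qed (use True in simp_all)
  qed (simp add: primitive_const)
  then show "chain_from 0 N ?P" unfolding chain_from_def by simp
  have "p \<in> borel_on I" using S_space_antimono[OF p, of 0] by simp
  then show "p = lift (?P 0)" using lift_wderiv_0 by simp
qed

text \<open>Monotonicity at level \<open>j - 1\<close> is available from \<open>j = k\<close> on.
  One-sided continuity makes the nonnegativity hold at every point rather than almost
  everywhere.\<close>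

lemma F_plus_nonneg:
  assumes f: "f \<in> F_plus I w k n" and "1 \<le> k" "k \<le> j" "j \<le> n" "x \<in> I"
  shows "wderiv I w j f x \<ge> 0"
proof -
  obtain i where j: "j = Suc i" using assms by (cases j) auto
  have S: "f \<in> S_space I w n" using f unfolding F_plus_def by blast
  have i: "i < n" "i \<in> {k - 1..n}" using j assms by auto
  show ?thesis unfolding j
  proof (rule one_sided_continuous_nonneg[where w = "w (Suc i)" and r = "wderiv I w (Suc i) f",
        OF _ _ _ wderiv_primitive(1)[OF S i(1)]])
    show "mono_on I (wderiv I w i f)" using f i(2) unfolding F_plus_def by blast
    show "if ereal x = Sup (ereal ` I) then continuous (at_left x) (wderiv I w (Suc i) f)
      else continuous (at_right x) (wderiv I w (Suc i) f)" if "x \<in> I" for x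
      using wderiv_primitive(2)[OF S i(1)] that unfolding RC_def by blast
  qed (use w_pos \<open>x \<in> I\<close> in auto)
qed

lemma interval_integral_primitive:
  assumes int: "\<And>z x. z \<in> I \<Longrightarrow> x \<in> I \<Longrightarrow> set_integrable lborel {z..x} d" and "c \<in> I"
  shows "primitive I d (\<lambda>x. LBINT s=ereal c..ereal x. d s)"
  unfolding primitive_def
proof (intro ballI impI)
  fix x z assume xz: "x \<in> I" "z \<in> I" "z \<le> x"
  define l u where "l = min c (min z x)" and "u = max c (max z x)"
  have "l \<in> I" "u \<in> I" "l \<le> u" using xz \<open>c \<in> I\<close> by (auto simp: l_def u_def min_def max_def)
  then have "interval_lebesgue_integrable lborel (ereal l) (ereal u) d"
    using int[of l u] interval_integrable_iff[of l u d] by simp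
  moreover have "ereal l = min (ereal c) (min (ereal z) (ereal x))"
    "ereal u = max (ereal c) (max (ereal z) (ereal x))"
    by (auto simp: l_def u_def min_def max_def)
  ultimately have "(LBINT s=ereal c..ereal z. d s) + (LBINT s=ereal z..ereal x. d s) =
      (LBINT s=ereal c..ereal x. d s)"
    by (intro interval_integral_sum) simp
  then show "set_integrable lborel {z..x} d \<and>
      (LBINT s=ereal c..ereal x. d s) - (LBINT s=ereal c..ereal z. d s) = (LINT s:{z..x}|lborel. d s)"
    using int[OF xz(2,1)] interval_integral_Icc[OF xz(3), of d] by simp
qed

end

section \<open>Monotone approximation\<close>

text \<open>Nonnegativity is included so that the sequence and its negative both have increasing
  images under \<open>ennreal\<close>.\<close>

definition increases_to :: "(nat \<Rightarrow> real) \<Rightarrow> real \<Rightarrow> bool" where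
  "increases_to s L \<longleftrightarrow> (\<forall>m. 0 \<le> s m) \<and> incseq s \<and> s \<longlonglongrightarrow> L"

lemma increases_to_le:
  assumes "increases_to s L"
  shows "0 \<le> s m" "s m \<le> L" "0 \<le> L"
proof -
  show a: "0 \<le> s m" "s m \<le> L"
    using assms incseq_le unfolding increases_to_def by blast+
  then show "0 \<le> L" by linarith
qed

lemma increases_to_zero: "increases_to s 0 \<Longrightarrow> s m = 0"
  using increases_to_le(1,2)[of s 0 m] by simp

lemma increases_to_mult:
  assumes "increases_to s L" "0 \<le> c"
  shows "increases_to (\<lambda>m. c * s m) (c * L)"
  using assms unfolding increases_to_def
  by (auto intro!: mult_nonneg_nonneg tendsto_mult_left simp: incseq_def mult_left_mono)

lemma increases_to_add_const:
  assumes "increases_to s L" "0 \<le> c"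
  shows "increases_to (\<lambda>m. c + s m) (c + L)"
  using assms unfolding increases_to_def
  by (auto intro!: tendsto_add tendsto_const add_nonneg_nonneg simp: incseq_def)

text \<open>The limit \<open>e\<close> is itself an integrable bound for all terms.\<close>

lemma set_integral_increases_to:
  assumes "A \<in> sets lborel" "\<And>m. set_borel_measurable lborel A (d m)" "set_integrable lborel A e"
    and inc: "\<And>s. s \<in> A \<Longrightarrow> increases_to (\<lambda>m. d m s) (e s)"
  shows "set_integrable lborel A (d m)"
    and "increases_to (\<lambda>m. LINT s:A|lborel. d m s) (LINT s:A|lborel. e s)"
proof -
  have le: "norm (d m s) \<le> e s" if "s \<in> A" for m s
    using increases_to_le(1,2)[OF inc[OF that], of m] by simp
  have "norm (d m s) \<le> norm (e s)" if "s \<in> A" for m s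
    using order_trans[OF le[OF that] abs_ge_self] by simp
  then have "AE s in lborel. s \<in> A \<longrightarrow> norm (d m s) \<le> norm (e s)" for m by simp
  then show int: "set_integrable lborel A (d m)" for m
    by (rule set_integrable_bound[OF assms(3,2)])
  have "(\<lambda>m. LINT s:A|lborel. d m s) \<longlonglongrightarrow> (LINT s:A|lborel. e s)"
    unfolding set_lebesgue_integral_def
  proof (rule integral_dominated_convergence)
    show "integrable lborel (\<lambda>x. indicator A x *\<^sub>R e x)" using assms(3) by (simp add: set_integrable_def)
    then show "(\<lambda>x. indicator A x *\<^sub>R e x) \<in> borel_measurable lborel" by (rule borel_measurable_integrable)
    show "(\<lambda>x. indicator A x *\<^sub>R d m x) \<in> borel_measurable lborel" for m
      using assms(2) unfolding set_borel_measurable_def .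
    have "(\<lambda>m. indicator A x *\<^sub>R d m x) \<longlonglongrightarrow> indicator A x *\<^sub>R e x" for x
      using inc[of x] unfolding increases_to_def by (cases "x \<in> A") simp_all
    then show "AE x in lborel. (\<lambda>m. indicator A x *\<^sub>R d m x) \<longlonglongrightarrow> indicator A x *\<^sub>R e x" by simp
    have "norm (indicator A x *\<^sub>R d m x) \<le> indicator A x *\<^sub>R e x" for x m
      using le[of x m] by (cases "x \<in> A") simp_all
    then show "AE x in lborel. norm (indicator A x *\<^sub>R d m x) \<le> indicator A x *\<^sub>R e x" for m by simp
  qed
  moreover have "incseq (\<lambda>m. LINT s:A|lborel. d m s)"
  proof (rule incseq_SucI)
    fix m
    show "(LINT s:A|lborel. d m s) \<le> (LINT s:A|lborel. d (Suc m) s)"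
      using inc by (intro set_integral_mono int) (auto simp: increases_to_def incseq_Suc_iff)
  qed
  moreover have "0 \<le> (LINT s:A|lborel. d m s)" for m
    unfolding set_lebesgue_integral_def
  proof (rule Bochner_Integration.integral_nonneg)
    show "0 \<le> indicator A x *\<^sub>R d m x" for x
      using increases_to_le(1)[OF inc[of x], of m] by (cases "x \<in> A") simp_all
  qed
  ultimately show "increases_to (\<lambda>m. LINT s:A|lborel. d m s) (LINT s:A|lborel. e s)"
    unfolding increases_to_def by blast
qed

text \<open>Rounds down to the largest of the first \<open>m\<close> enumerated rationals. The
  growing stock of values gives monotonicity in \<open>m\<close>; for fixed \<open>m\<close> the
  function is nondecreasing in \<open>y\<close> with finitely many values. The inserted 0 keeps
  \<open>Max\<close> away from the empty set and the result nonnegative.\<close>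

definition rational_below :: "nat \<Rightarrow> real \<Rightarrow> real" where
  "rational_below m y = Max (insert 0 {q \<in> from_nat_into \<rat> ` {..<m}. q \<le> y})"

lemma rational_below_mono: "y \<le> y' \<Longrightarrow> rational_below m y \<le> rational_below m y'"
  unfolding rational_below_def by (rule Max_mono) auto

lemma rational_below_range: "rational_below m y \<in> insert 0 (from_nat_into \<rat> ` {..<m})"
proof -
  let ?S = "insert 0 {q \<in> from_nat_into \<rat> ` {..<m}. q \<le> y}"
  have "Max ?S \<in> ?S" by (rule Max_in) auto
  then show ?thesis unfolding rational_below_def by blast
qed

lemma rational_below_nonneg: "0 \<le> rational_below m y"
  unfolding rational_below_def by (rule Max_ge) auto

lemma rational_below_increases_to:
  assumes "0 \<le> y"
  shows "increases_to (\<lambda>m. rational_below m y) y"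
proof -
  have le: "rational_below m y \<le> y" for m
    unfolding rational_below_def using assms by (subst Max_le_iff) auto
  have inc: "incseq (\<lambda>m. rational_below m y)"
    unfolding rational_below_def by (intro incseq_SucI Max_mono) auto
  have "(\<lambda>m. rational_below m y) \<longlonglongrightarrow> y"
  proof (rule increasing_tendsto)
    fix l assume "l < y"
    then obtain q where q: "q \<in> \<rat>" "l < q" "q < y" using Rats_dense_in_real by blast
    then obtain i where i: "q = from_nat_into \<rat> i"
      using from_nat_into_surj[OF countable_rat] by metis
    have "l < rational_below m y" if "i < m" for m
    proof -
      have "q \<le> rational_below m y"
        unfolding rational_below_def by (rule Max_ge) (use q i that in auto)
      then show ?thesis using q by linarith
    qed
    then show "\<forall>\<^sub>F m in sequentially. l < rational_below m y"
      by (auto simp: eventually_sequentially intro!: exI[of _ "Suc i"])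
  qed (simp add: le)
  then show ?thesis using inc rational_below_nonneg unfolding increases_to_def by blast
qed

text \<open>Rounding toward zero: the absolute value increases to that of \<open>y\<close> for
  either sign, and monotonicity in \<open>y\<close> is retained.\<close>

definition rational_toward :: "nat \<Rightarrow> real \<Rightarrow> real" where
  "rational_toward m y = (if 0 \<le> y then rational_below m y else - rational_below m (- y))"

lemma rational_toward_mono: "mono (rational_toward m)"
proof (rule monoI)
  fix y y' :: real assume "y \<le> y'"
  then show "rational_toward m y \<le> rational_toward m y'"
    using rational_below_mono[of y y' m] rational_below_mono[of "- y'" "- y" m]
      rational_below_nonneg[of m y'] rational_below_nonneg[of m "- y"]
    unfolding rational_toward_def by auto
qed

lemma rational_toward_finite: "finite (range (rational_toward m))"
proof (rule finite_subset)
  let ?S = "insert 0 (from_nat_into \<rat> ` {..<m})"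
  show "range (rational_toward m) \<subseteq> ?S \<union> uminus ` ?S"
  proof
    fix v assume "v \<in> range (rational_toward m)"
    then obtain y where "v = rational_toward m y" by blast
    then show "v \<in> ?S \<union> uminus ` ?S"
      using rational_below_range[of m y] imageI[OF rational_below_range[of m "- y"], of uminus]
      unfolding rational_toward_def by (metis UnI1 UnI2)
  qed
qed simp

lemma rational_toward_increases_to:
  "0 \<le> y \<Longrightarrow> increases_to (\<lambda>m. rational_toward m y) y"
  "y \<le> 0 \<Longrightarrow> increases_to (\<lambda>m. - rational_toward m y) (- y)"
proof -
  show *: "0 \<le> y \<Longrightarrow> increases_to (\<lambda>m. rational_toward m y) y" for y
    using rational_below_increases_to unfolding rational_toward_def by simp
  \<comment> \<open>At \<open>y = 0\<close> the first branch of the definition applies, and its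
    value there is 0.\<close>
  show "y \<le> 0 \<Longrightarrow> increases_to (\<lambda>m. - rational_toward m y) (- y)"
    using rational_below_increases_to[of "- y"] increases_to_zero[OF *[of 0]] *[of 0]
    unfolding rational_toward_def by (cases "y = 0") auto
qed

section \<open>Integration from the left end\<close>

context nondegenerate_interval
begin

text \<open>The left end may belong to I, be finite and outside I, or be infinite. The sequence
  hides the distinction and lets \<open>I \<inter> {..x}\<close> be exhausted by compact
  intervals.\<close>

lemma coinitial_sequence:
  assumes "x \<in> I"
  obtains z :: "nat \<Rightarrow> real" where "\<And>i. z i \<in> I" "\<And>i. z i \<le> x" "decseq z" "\<And>y. y \<in> I \<Longrightarrow> \<exists>i. z i \<le> y"
proof -
  have mem: "u \<in> I" if "y \<in> I" "y \<le> u" "u \<le> x" for u y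
    using atLeastAtMost_subset[OF that(1) assms] that by auto
  consider (min) m where "m \<in> I" "\<And>y. y \<in> I \<Longrightarrow> m \<le> y"
    | (bdd) "bdd_below I" "\<And>m. m \<in> I \<Longrightarrow> \<exists>y\<in>I. y < m"
    | (unbdd) "\<not> bdd_below I"
    by (meson not_le)
  then show ?thesis
  proof cases
    case min
    show ?thesis
      by (rule that[of "\<lambda>_. m"]) (use min assms in \<open>auto simp: decseq_def\<close>)
  next
    case bdd
    define a where "a = Inf I"
    have lt: "a < y" if y: "y \<in> I" for y
    proof -
      obtain y' where "y' \<in> I" "y' < y" using bdd(2)[OF y] by blast
      then show ?thesis using cInf_lower[OF _ bdd(1)] unfolding a_def by force
    qed
    have ax: "a < x" by (rule lt[OF assms])
    let ?z = "\<lambda>i. a + (x - a) / real (Suc i)"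
    show ?thesis
    proof (rule that[of ?z])
      have zx: "?z i \<le> x" for i
      proof -
        have "(x - a) / real (Suc i) \<le> (x - a) / 1" using ax by (intro divide_left_mono) auto
        then show ?thesis by simp
      qed
      then show "?z i \<le> x" for i .
      show "?z i \<in> I" for i
      proof -
        have "Inf I < ?z i" using ax unfolding a_def by simp
        then obtain y where "y \<in> I" "y < ?z i"
          using cInf_less_iff[of I] assms bdd(1) by blast
        then show ?thesis using mem[OF _ _ zx] by simp
      qed
      show "decseq ?z" using ax by (auto simp: decseq_def intro!: divide_left_mono)
      show "\<exists>i. ?z i \<le> y" if "y \<in> I" for y
      proof -
        have "0 < y - a" using lt[OF that] by simp
        then obtain i where "(x - a) / (y - a) < real i" using reals_Archimedean2 by blast
        then have "(x - a) / real (Suc i) \<le> y - a"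
          using \<open>0 < y - a\<close> by (simp add: field_simps)
        then show ?thesis by (intro exI[of _ i]) simp
      qed
    qed
  next
    case unbdd
    show ?thesis
    proof (rule that[of "\<lambda>i. x - real i"])
      show "x - real i \<in> I" for i
      proof -
        obtain y where "y \<in> I" "y < x - real i" using unbdd unfolding bdd_below_def by (meson not_le)
        then show ?thesis using mem by simp
      qed
      show "\<exists>i. x - real i \<le> y" for y
      proof -
        obtain i where "x - y \<le> real i" using real_arch_simple by blast
        then show ?thesis by (intro exI[of _ i]) simp
      qed
    qed (auto simp: decseq_def)
  qed
qed

text \<open>The integral over \<open>{z i..x}\<close> is \<open>v x - v (z i)\<close>, hence at most
  \<open>v x\<close>, and monotone convergence yields the integral from the left end. The deficit in
  the inequality is the limit of \<open>v\<close> at that end.\<close>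

lemma primitive_left_integrable:
  assumes p: "primitive I d v" and d: "\<And>x. x \<in> I \<Longrightarrow> 0 \<le> d x" and v: "\<And>x. x \<in> I \<Longrightarrow> 0 \<le> v x"
    and "x \<in> I" and meas: "set_borel_measurable lborel (I \<inter> {..x}) d"
  shows "set_integrable lborel (I \<inter> {..x}) d" "(LINT s:I \<inter> {..x}|lborel. d s) \<le> v x"
proof -
  obtain z :: "nat \<Rightarrow> real" where z: "\<And>i. z i \<in> I" "\<And>i. z i \<le> x" "decseq z"
    "\<And>y. y \<in> I \<Longrightarrow> \<exists>i. z i \<le> y" using coinitial_sequence[OF \<open>x \<in> I\<close>] by metis
  have sub: "{z i..x} \<subseteq> I" for i using atLeastAtMost_subset[OF z(1) \<open>x \<in> I\<close>] .
  let ?a = "\<lambda>i. LINT s:{z i..x}|lborel. d s"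
  have a: "?a i = v x - v (z i)" for i using primitive_eq[OF p \<open>x \<in> I\<close> z(1,2)] by simp
  have "incseq ?a"
    unfolding a using mono_onD[OF primitive_mono[OF p d]] z(1,3) by (auto simp: incseq_def decseq_def)
  moreover have "?a i \<le> v x" for i using v[OF z(1)] unfolding a by simp
  ultimately obtain l where l: "?a \<longlonglongrightarrow> l" using incseq_convergent[of ?a "v x"] by blast
  have "has_bochner_integral lborel (\<lambda>s. indicator (I \<inter> {..x}) s *\<^sub>R d s) l"
  proof (rule has_bochner_integral_monotone_convergence)
    show "integrable lborel (\<lambda>s. indicator {z i..x} s *\<^sub>R d s)" for i
      using primitive_integrable[OF p \<open>x \<in> I\<close> z(1)] unfolding set_integrable_def .
    show "AE s in lborel. mono (\<lambda>i. indicator {z i..x} s *\<^sub>R d s)"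
    proof (rule AE_I2, rule monoI)
      fix s i j assume "i \<le> (j::nat)"
      then have "z j \<le> z i" using z(3) by (simp add: decseq_def)
      then show "indicator {z i..x} s *\<^sub>R d s \<le> indicator {z j..x} s *\<^sub>R d s"
        using d[of s] subsetD[OF sub[of j], of s] by (simp add: indicator_def)
    qed
    have "(\<lambda>i. indicator {z i..x} s *\<^sub>R d s) \<longlonglongrightarrow> indicator (I \<inter> {..x}) s *\<^sub>R d s" for s
    proof (rule tendsto_eventually)
      show "\<forall>\<^sub>F i in sequentially. indicator {z i..x} s *\<^sub>R d s = indicator (I \<inter> {..x}) s *\<^sub>R d s"
      proof (cases "s \<in> I")
        case True
        then obtain j where "z j \<le> s" using z(4) by blast
        then have "z i \<le> s" if "j \<le> i" for i using z(3) that order_trans unfolding decseq_def by blast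
        then show ?thesis using True by (auto simp: eventually_sequentially indicator_def intro!: exI[of _ j])
      next
        case False
        then have "s \<notin> {z i..x}" for i using sub by blast
        then show ?thesis using False by (simp add: indicator_def)
      qed
    qed
    then show "AE s in lborel. (\<lambda>i. indicator {z i..x} s *\<^sub>R d s) \<longlonglongrightarrow> indicator (I \<inter> {..x}) s *\<^sub>R d s"
      by simp
    show "(\<lambda>i. LINT s|lborel. indicator {z i..x} s *\<^sub>R d s) \<longlonglongrightarrow> l"
      using l unfolding set_lebesgue_integral_def .
    show "(\<lambda>s. indicator (I \<inter> {..x}) s *\<^sub>R d s) \<in> borel_measurable lborel"
      using meas unfolding set_borel_measurable_def .
  qed
  then show "set_integrable lborel (I \<inter> {..x}) d" "(LINT s:I \<inter> {..x}|lborel. d s) \<le> v x"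
    unfolding set_integrable_def set_lebesgue_integral_def
    using LIMSEQ_le_const2[OF l, of "v x"] \<open>\<And>i. ?a i \<le> v x\<close>
    by (auto simp: has_bochner_integral_iff)
qed

lemma left_integral_primitive:
  assumes int: "\<And>x. x \<in> I \<Longrightarrow> set_integrable lborel (I \<inter> {..x}) d"
  shows "primitive I d (\<lambda>x. LINT s:I \<inter> {..x}|lborel. d s)"
  unfolding primitive_def
proof (intro ballI impI conjI)
  fix x z assume xz: "x \<in> I" "z \<in> I" "z \<le> x"
  have sub: "{z..x} \<subseteq> I" by (rule atLeastAtMost_subset[OF xz(2,1)])
  show 1: "set_integrable lborel {z..x} d"
    by (rule set_integrable_subset[OF int[OF xz(1)]]) (use sub in auto)
  have 2: "set_integrable lborel {z<..x} d"
    by (rule set_integrable_subset[OF 1]) auto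
  have "I \<inter> {..x} = (I \<inter> {..z}) \<union> {z<..x}" using sub xz by auto
  then have "(LINT s:I \<inter> {..x}|lborel. d s) =
      (LINT s:I \<inter> {..z}|lborel. d s) + (LINT s:{z<..x}|lborel. d s)"
    using set_integral_Un[OF _ int[OF xz(2)] 2] by (simp add: disjoint_iff)
  moreover have "(LINT s:{z<..x}|lborel. d s) = (LINT s:{z..x}|lborel. d s)"
    by (rule set_integral_discrete_difference[where X = "{z}"]) auto
  ultimately show "(LINT s:I \<inter> {..x}|lborel. d s) - (LINT s:I \<inter> {..z}|lborel. d s) =
      (LINT s:{z..x}|lborel. d s)" by simp
qed

end

context gauge_interval
begin

text \<open>For a nonnegative primitive \<open>v\<close> the integral of \<open>d\<close> from the left end of the interval converges,
  and approximations of \<open>d\<close> are integrated from there with initial value \<open>v(a+)\<close>.\<close>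

lemma primitive_approx_left:
  assumes p: "primitive I d v" and d: "d \<in> borel_measurable borel_I"
    and v: "\<And>x. x \<in> I \<Longrightarrow> 0 \<le> v x"
    and e: "\<And>m. e m \<in> borel_measurable borel_I"
    and inc: "\<And>x. x \<in> I \<Longrightarrow> increases_to (\<lambda>m. e m x) (d x)"
  obtains u where "\<And>m. primitive I (e m) (u m)" "\<And>x. x \<in> I \<Longrightarrow> increases_to (\<lambda>m. u m x) (v x)"
proof -
  define J where "J = (\<lambda>f x. LINT s:I \<inter> {..x}|lborel. (f s :: real))"
  have A: "I \<inter> {..x} \<in> sets borel" for x by simp
  have meas: "set_borel_measurable lborel (I \<inter> {..x}) f" if "f \<in> borel_measurable borel_I" for f :: "real \<Rightarrow> real" and x
    by (rule set_borel_measurable_subset_I[OF that A]) simp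
  have d0: "0 \<le> d x" if "x \<in> I" for x using increases_to_le(3)[OF inc[OF that]] .
  have int: "set_integrable lborel (I \<inter> {..x}) d" "J d x \<le> v x" if "x \<in> I" for x
    using primitive_left_integrable[OF p d0 v that meas[OF d]] unfolding J_def by blast+
  have e_int: "set_integrable lborel (I \<inter> {..x}) (e m)" if "x \<in> I" for x m
    by (rule set_integral_increases_to(1)[OF _ meas[OF e] int(1)[OF that] inc]) auto
  have e_inc: "increases_to (\<lambda>m. J (e m) x) (J d x)" if "x \<in> I" for x
    unfolding J_def by (rule set_integral_increases_to(2)[OF _ meas[OF e] int(1)[OF that] inc]) auto
  have Jp: "primitive I f (J f)" if "\<And>x. x \<in> I \<Longrightarrow> set_integrable lborel (I \<inter> {..x}) f" for f
    unfolding J_def by (rule left_integral_primitive[OF that])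
  \<comment> \<open>In the witness, \<open>v x - J d x\<close> does not depend on \<open>x\<close>,
    as both terms are primitives of \<open>d\<close>. It is the limit of \<open>v\<close> at the
    left end, and it is nonnegative.\<close>
  show ?thesis
  proof (rule that[of "\<lambda>m x. (v x - J d x) + J (e m) x"])
    show "primitive I (e m) (\<lambda>x. (v x - J d x) + J (e m) x)" for m
      by (rule primitive_cong[OF primitive_add[OF primitive_diff[OF p Jp[OF int(1)]] Jp[OF e_int]]]) auto
    fix x assume "x \<in> I"
    have "0 \<le> v x - J d x" using int(2)[OF \<open>x \<in> I\<close>] by simp
    from increases_to_add_const[OF e_inc[OF \<open>x \<in> I\<close>] this]
    show "increases_to (\<lambda>m. (v x - J d x) + J (e m) x) (v x)" by simp
  qed
qed

text \<open>To the left of \<open>c\<close> the oriented integral from \<open>c\<close> is minus the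
  integral over the interval in between. The sign \<open>\<sigma>\<close> of the integrand there
  becomes \<open>- \<sigma>\<close> for the primitive, while nothing changes on the right.\<close>

lemma primitive_approx_base:
  assumes int: "\<And>z x. z \<in> I \<Longrightarrow> x \<in> I \<Longrightarrow> set_integrable lborel {z..x} d" and "c \<in> I"
    and e: "\<And>m. e m \<in> borel_measurable borel_I" and \<sigma>: "\<bar>\<sigma>\<bar> = 1"
    and right: "\<And>x. x \<in> I \<Longrightarrow> c \<le> x \<Longrightarrow> increases_to (\<lambda>m. e m x) (d x)"
    and left: "\<And>x. x \<in> I \<Longrightarrow> x < c \<Longrightarrow> increases_to (\<lambda>m. \<sigma> * e m x) (\<sigma> * d x)"
  obtains v u where "primitive I d v" "\<And>m. primitive I (e m) (u m)"
    "\<And>x. x \<in> I \<Longrightarrow> c \<le> x \<Longrightarrow> increases_to (\<lambda>m. u m x) (v x)"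
    "\<And>x. x \<in> I \<Longrightarrow> x < c \<Longrightarrow> increases_to (\<lambda>m. - \<sigma> * u m x) (- \<sigma> * v x)"
proof -
  define B where "B = (\<lambda>f x. LBINT s=ereal c..ereal x. (f s :: real))"
  have le: "norm (e m x) \<le> norm (d x)" if "x \<in> I" for m x
  proof (cases "c \<le> x")
    case True
    then show ?thesis using increases_to_le(1,2)[OF right[OF that True], of m] by simp
  next
    case False
    then have "increases_to (\<lambda>m. \<sigma> * e m x) (\<sigma> * d x)" using left that by simp
    from increases_to_le(1,2)[OF this, of m] have "\<bar>\<sigma> * e m x\<bar> \<le> \<bar>\<sigma> * d x\<bar>" by simp
    then show ?thesis using \<sigma> by (simp add: abs_mult)
  qed
  have e_int: "set_integrable lborel {z..x} (e m)" if "z \<in> I" "x \<in> I" for z x m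
  proof (rule set_integrable_bound[OF int[OF that]])
    note sub = atLeastAtMost_subset[OF that]
    show "set_borel_measurable lborel {z..x} (e m)"
      by (rule set_borel_measurable_subset_I[OF e _ sub]) simp
    show "AE s in lborel. s \<in> {z..x} \<longrightarrow> norm (e m s) \<le> norm (d s)"
      using le sub by (auto intro!: AE_I2)
  qed
  have ioo_int: "set_integrable lborel {z<..<x} d" if "z \<in> I" "x \<in> I" for z x
    by (rule set_integrable_subset[OF int[OF that]]) auto
  have ioo_meas: "set_borel_measurable lborel {z<..<x} (e m)" if "z \<in> I" "x \<in> I" for z x m
    by (rule set_borel_measurable_subset_I[OF e]) (use atLeastAtMost_subset[OF that] in auto)
  show ?thesis
  proof (rule that[of "B d" "\<lambda>m. B (e m)"])
    show "primitive I d (B d)" "primitive I (e m) (B (e m))" for m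
      unfolding B_def using interval_integral_primitive int e_int \<open>c \<in> I\<close> by blast+
  next
    fix x assume x: "x \<in> I" "c \<le> x"
    have B: "B f x = (LINT s:{c<..<x}|lborel. f s)" for f
      using x(2) unfolding B_def by (simp add: interval_lebesgue_integral_def)
    show "increases_to (\<lambda>m. B (e m) x) (B d x)"
      unfolding B
    proof (rule set_integral_increases_to(2)[OF _ ioo_meas[OF \<open>c \<in> I\<close> x(1)] ioo_int[OF \<open>c \<in> I\<close> x(1)]])
      show "increases_to (\<lambda>m. e m s) (d s)" if "s \<in> {c<..<x}" for s
        using right[of s] subsetD[OF atLeastAtMost_subset[OF \<open>c \<in> I\<close> x(1)], of s] that by simp
    qed simp
  next
    fix x assume x: "x \<in> I" "x < c"
    have B: "- \<sigma> * B f x = (LINT s:{x<..<c}|lborel. \<sigma> * f s)" for f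
      using x(2) unfolding B_def by (simp add: interval_lebesgue_integral_def)
    show "increases_to (\<lambda>m. - \<sigma> * B (e m) x) (- \<sigma> * B d x)"
      unfolding B
    proof (rule set_integral_increases_to(2))
      show "set_borel_measurable lborel {x<..<c} (\<lambda>s. \<sigma> * e m s)" for m
        by (rule set_borel_measurable_subset_I)
          (use e atLeastAtMost_subset[OF x(1) \<open>c \<in> I\<close>] in auto)
      show "set_integrable lborel {x<..<c} (\<lambda>s. \<sigma> * d s)"
        using ioo_int[OF x(1) \<open>c \<in> I\<close>] by simp
      show "increases_to (\<lambda>m. \<sigma> * e m s) (\<sigma> * d s)" if "s \<in> {x<..<c}" for s
        using left[of s] subsetD[OF atLeastAtMost_subset[OF x(1) \<open>c \<in> I\<close>], of s] that by simp
    qed simp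
  qed
qed

end

section \<open>Comparison of integrals against two measures\<close>

text \<open>The inequality between the two extended integrals, with the negative parts moved across so
  that no subtraction of infinite values occurs.\<close>

definition dominates :: "real measure \<Rightarrow> real measure \<Rightarrow> (real \<Rightarrow> real) \<Rightarrow> bool" where
  "dominates \<nu>1 \<nu>2 f \<longleftrightarrow>
     (\<integral>\<^sup>+x. ennreal (- f x) \<partial>\<nu>1) < \<infinity> \<and> (\<integral>\<^sup>+x. ennreal (- f x) \<partial>\<nu>2) < \<infinity> \<and>
     (\<integral>\<^sup>+x. ennreal (f x) \<partial>\<nu>2) + (\<integral>\<^sup>+x. ennreal (- f x) \<partial>\<nu>1) \<le>
     (\<integral>\<^sup>+x. ennreal (f x) \<partial>\<nu>1) + (\<integral>\<^sup>+x. ennreal (- f x) \<partial>\<nu>2)"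

text \<open>Existence rules out two infinite parts, so an infinite negative part would force the
  value \<open>-\<infinity>\<close>.\<close>

lemma neg_part_finite:
  assumes "has_ext_integral \<nu> f" "ext_integral \<nu> f > -\<infinity>"
  shows "(\<integral>\<^sup>+x. ennreal (- f x) \<partial>\<nu>) < \<infinity>"
proof (rule ccontr)
  assume "\<not> (\<integral>\<^sup>+x. ennreal (- f x) \<partial>\<nu>) < \<infinity>"
  then have inf: "(\<integral>\<^sup>+x. ennreal (- f x) \<partial>\<nu>) = \<infinity>"
    by (metis infinity_ennreal_def top.not_eq_extremum)
  then have "(\<integral>\<^sup>+x. ennreal (f x) \<partial>\<nu>) < \<infinity>" using assms(1) unfolding has_ext_integral_def by auto
  then obtain r where "enn2ereal (\<integral>\<^sup>+x. ennreal (f x) \<partial>\<nu>) = ereal r"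
    by (cases "\<integral>\<^sup>+x. ennreal (f x) \<partial>\<nu>" rule: ennreal_cases) (auto simp: enn2ereal_ennreal)
  then show False using assms(2) inf unfolding ext_integral_def by simp
qed

lemma ext_integral_finite_parts:
  assumes "has_ext_integral \<nu> f" "ext_integral \<nu> f \<in> range ereal"
  shows "(\<integral>\<^sup>+x. ennreal (f x) \<partial>\<nu>) < \<infinity>" "(\<integral>\<^sup>+x. ennreal (- f x) \<partial>\<nu>) < \<infinity>"
proof -
  show n: "(\<integral>\<^sup>+x. ennreal (- f x) \<partial>\<nu>) < \<infinity>"
    using assms by (intro neg_part_finite) auto
  show "(\<integral>\<^sup>+x. ennreal (f x) \<partial>\<nu>) < \<infinity>"
    using n assms(2) unfolding ext_integral_def
    by (cases "\<integral>\<^sup>+x. ennreal (f x) \<partial>\<nu>" rule: ennreal_cases;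
        cases "\<integral>\<^sup>+x. ennreal (- f x) \<partial>\<nu>" rule: ennreal_cases) (auto simp: enn2ereal_ennreal)
qed

lemma ennreal_diff_le_iff:
  assumes "b < \<infinity>" "d < \<infinity>"
  shows "enn2ereal c - enn2ereal d \<le> enn2ereal a - enn2ereal b \<longleftrightarrow> c + b \<le> a + d"
  using assms
  by (cases a rule: ennreal_cases; cases b rule: ennreal_cases; cases c rule: ennreal_cases;
      cases d rule: ennreal_cases)
    (auto simp: enn2ereal_ennreal top_unique simp flip: ennreal_plus)

lemma dominates_iff:
  assumes "(\<integral>\<^sup>+x. ennreal (- f x) \<partial>\<nu>1) < \<infinity>" "(\<integral>\<^sup>+x. ennreal (- f x) \<partial>\<nu>2) < \<infinity>"
  shows "dominates \<nu>1 \<nu>2 f \<longleftrightarrow> ext_integral_ge \<nu>1 \<nu>2 f"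
  using assms ennreal_diff_le_iff[OF assms]
  unfolding dominates_def ext_integral_ge_def has_ext_integral_def ext_integral_def by simp

lemma ennreal_parts_add:
  "ennreal (x + y) + (ennreal (- x) + ennreal (- y)) =
    ennreal x + ennreal y + ennreal (- (x + y))"
  by (cases "0 \<le> x"; cases "0 \<le> y"; cases "0 \<le> x + y")
    (auto simp: ennreal_neg simp flip: ennreal_plus)

lemma ennreal_neg_add_le: "ennreal (- (x + y)) \<le> ennreal (- x) + ennreal (- y)"
  by (cases "0 \<le> x"; cases "0 \<le> y")
    (auto simp: ennreal_neg intro: ennreal_leI simp flip: ennreal_plus)

text \<open>The positive part of a sum is not the sum of the positive parts.
  \<open>ennreal_parts_add\<close> repairs this without subtraction, by correction terms that are
  negative parts and hence finite.\<close>

lemma dominates_add: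
  assumes "dominates \<nu>1 \<nu>2 f" "dominates \<nu>1 \<nu>2 g"
    and [measurable]: "f \<in> borel_measurable \<nu>1" "f \<in> borel_measurable \<nu>2"
      "g \<in> borel_measurable \<nu>1" "g \<in> borel_measurable \<nu>2"
  shows "dominates \<nu>1 \<nu>2 (\<lambda>x. f x + g x)"
proof -
  define P N where "P = (\<lambda>\<nu> h. \<integral>\<^sup>+x. ennreal (h x) \<partial>(\<nu> :: real measure))"
    and "N = (\<lambda>\<nu> h. \<integral>\<^sup>+x. ennreal (- h x :: real) \<partial>(\<nu> :: real measure))"
  let ?h = "\<lambda>x. f x + g x"
  have eq: "P \<nu> ?h + (N \<nu> f + N \<nu> g) = P \<nu> f + P \<nu> g + N \<nu> ?h" and le: "N \<nu> ?h \<le> N \<nu> f + N \<nu> g"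
    if [measurable]: "f \<in> borel_measurable \<nu>" "g \<in> borel_measurable \<nu>" for \<nu>
  proof -
    have "P \<nu> ?h + (N \<nu> f + N \<nu> g) = (\<integral>\<^sup>+x. ennreal (f x + g x) + (ennreal (- f x) + ennreal (- g x)) \<partial>\<nu>)"
      unfolding P_def N_def by (simp add: nn_integral_add)
    also have "\<dots> = (\<integral>\<^sup>+x. ennreal (f x) + ennreal (g x) + ennreal (- (f x + g x)) \<partial>\<nu>)"
      by (simp only: ennreal_parts_add)
    also have "\<dots> = P \<nu> f + P \<nu> g + N \<nu> ?h"
      unfolding P_def N_def by (simp add: nn_integral_add)
    finally show "P \<nu> ?h + (N \<nu> f + N \<nu> g) = P \<nu> f + P \<nu> g + N \<nu> ?h" .
    have "N \<nu> ?h \<le> (\<integral>\<^sup>+x. ennreal (- f x) + ennreal (- g x) \<partial>\<nu>)"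
      unfolding N_def by (intro nn_integral_mono ennreal_neg_add_le)
    then show "N \<nu> ?h \<le> N \<nu> f + N \<nu> g"
      unfolding N_def by (simp add: nn_integral_add)
  qed
  have fin: "N \<nu>1 f < \<infinity>" "N \<nu>2 f < \<infinity>" "N \<nu>1 g < \<infinity>" "N \<nu>2 g < \<infinity>"
    and dom: "P \<nu>2 f + N \<nu>1 f \<le> P \<nu>1 f + N \<nu>2 f" "P \<nu>2 g + N \<nu>1 g \<le> P \<nu>1 g + N \<nu>2 g"
    using assms(1,2) unfolding dominates_def P_def N_def by blast+
  have finh: "N \<nu>1 ?h < \<infinity>" "N \<nu>2 ?h < \<infinity>"
    using le[of \<nu>1] le[of \<nu>2] fin by (auto intro: le_less_trans)
  \<comment> \<open>Both sides are padded by all negative parts of the summands. This finite amount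
    can be cancelled at the end, unlike the positive parts, which may be infinite.\<close>
  define C where "C = N \<nu>1 f + N \<nu>1 g + (N \<nu>2 f + N \<nu>2 g)"
  have "C < \<infinity>" using fin unfolding C_def by simp
  have "(P \<nu>2 ?h + N \<nu>1 ?h) + C =
      (P \<nu>2 ?h + (N \<nu>2 f + N \<nu>2 g)) + N \<nu>1 ?h + (N \<nu>1 f + N \<nu>1 g)"
    unfolding C_def by (simp add: ac_simps)
  also have "\<dots> = (P \<nu>2 f + N \<nu>1 f) + (P \<nu>2 g + N \<nu>1 g) + (N \<nu>1 ?h + N \<nu>2 ?h)"
    by (subst eq) (auto simp: ac_simps)
  also have "\<dots> \<le> (P \<nu>1 f + N \<nu>2 f) + (P \<nu>1 g + N \<nu>2 g) + (N \<nu>1 ?h + N \<nu>2 ?h)"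
    by (intro add_mono dom order_refl)
  also have "\<dots> = (P \<nu>1 f + P \<nu>1 g + N \<nu>1 ?h) + N \<nu>2 ?h + (N \<nu>2 f + N \<nu>2 g)"
    by (simp add: ac_simps)
  also have "\<dots> = (P \<nu>1 ?h + N \<nu>2 ?h) + C"
    unfolding C_def by (subst eq[symmetric]) (auto simp: ac_simps)
  finally have "P \<nu>2 ?h + N \<nu>1 ?h \<le> P \<nu>1 ?h + N \<nu>2 ?h"
    using \<open>C < \<infinity>\<close> by (metis add.commute ennreal_add_left_cancel_le infinity_ennreal_def less_irrefl)
  then show ?thesis using finh unfolding dominates_def P_def N_def by blast
qed

lemma nn_integral_increasing_limit:
  fixes g :: "nat \<Rightarrow> 'a \<Rightarrow> ennreal"
  assumes [measurable]: "\<And>m. g m \<in> borel_measurable M"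
    and inc: "\<And>x. x \<in> space M \<Longrightarrow> incseq (\<lambda>m. g m x)"
    and lim: "\<And>x. x \<in> space M \<Longrightarrow> (\<lambda>m. g m x) \<longlonglongrightarrow> u x"
  shows "(\<lambda>m. \<integral>\<^sup>+x. g m x \<partial>M) \<longlonglongrightarrow> (\<integral>\<^sup>+x. u x \<partial>M)"
proof -
  \<comment> \<open>Multiplication by the indicator makes the sequence monotone and convergent
    everywhere and leaves the integrals unchanged.\<close>
  let ?i = "indicator (space M) :: 'a \<Rightarrow> ennreal"
  have "(\<lambda>m. \<integral>\<^sup>+x. g m x * ?i x \<partial>M) \<longlonglongrightarrow> (\<integral>\<^sup>+x. u x * ?i x \<partial>M)"
  proof (rule nn_integral_LIMSEQ)
    show "incseq (\<lambda>m x. g m x * ?i x)"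
      using inc by (auto simp: incseq_def le_fun_def indicator_def)
    show "(\<lambda>m. g m x * ?i x) \<longlonglongrightarrow> u x * ?i x" for x
      using lim[of x] by (cases "x \<in> space M") simp_all
  qed measurable
  moreover have "(\<integral>\<^sup>+x. h x * ?i x \<partial>M) = (\<integral>\<^sup>+x. h x \<partial>M)" for h
    by (rule nn_integral_cong) simp
  ultimately show ?thesis by simp
qed

lemma increases_to_ennreal:
  assumes "increases_to s L"
  shows "incseq (\<lambda>m. ennreal (s m))" "(\<lambda>m. ennreal (s m)) \<longlonglongrightarrow> ennreal L"
    "incseq (\<lambda>m. ennreal (- s m))" "(\<lambda>m. ennreal (- s m)) \<longlonglongrightarrow> ennreal (- L)"
  using assms increases_to_le[OF assms] unfolding increases_to_def
  by (auto simp: incseq_def ennreal_neg intro: ennreal_leI tendsto_ennrealI)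

text \<open>At each point the approximants keep one sign and move away from zero, so their positive
  and negative parts both increase; the sign may vary with the point. Finiteness along the sequence
  does not pass to the limit, hence \<open>fin\<close>.\<close>

lemma dominates_limit:
  assumes dom: "\<And>m. dominates \<nu>1 \<nu>2 (s m)"
    and meas: "\<And>m. s m \<in> borel_measurable \<nu>1" "\<And>m. s m \<in> borel_measurable \<nu>2"
    and inc: "\<And>x. x \<in> space \<nu>1 \<union> space \<nu>2 \<Longrightarrow>
      increases_to (\<lambda>m. s m x) (f x) \<or> increases_to (\<lambda>m. - s m x) (- f x)"
    and fin: "(\<integral>\<^sup>+x. ennreal (- f x) \<partial>\<nu>1) < \<infinity>" "(\<integral>\<^sup>+x. ennreal (- f x) \<partial>\<nu>2) < \<infinity>"
  shows "dominates \<nu>1 \<nu>2 f"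
proof -
  have parts: "incseq (\<lambda>m. ennreal (s m x))" "(\<lambda>m. ennreal (s m x)) \<longlonglongrightarrow> ennreal (f x)"
    "incseq (\<lambda>m. ennreal (- s m x))" "(\<lambda>m. ennreal (- s m x)) \<longlonglongrightarrow> ennreal (- f x)"
    if "x \<in> space \<nu>1 \<union> space \<nu>2" for x
    using inc[OF that] increases_to_ennreal[of "\<lambda>m. s m x" "f x"]
      increases_to_ennreal[of "\<lambda>m. - s m x" "- f x"] by auto
  have lim: "(\<lambda>m. \<integral>\<^sup>+x. ennreal (s m x) \<partial>\<nu>) \<longlonglongrightarrow> (\<integral>\<^sup>+x. ennreal (f x) \<partial>\<nu>)"
    "(\<lambda>m. \<integral>\<^sup>+x. ennreal (- s m x) \<partial>\<nu>) \<longlonglongrightarrow> (\<integral>\<^sup>+x. ennreal (- f x) \<partial>\<nu>)"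
    if "\<nu> = \<nu>1 \<or> \<nu> = \<nu>2" for \<nu>
    using meas parts that by (auto intro!: nn_integral_increasing_limit)
  have "(\<integral>\<^sup>+x. ennreal (f x) \<partial>\<nu>2) + (\<integral>\<^sup>+x. ennreal (- f x) \<partial>\<nu>1) \<le>
     (\<integral>\<^sup>+x. ennreal (f x) \<partial>\<nu>1) + (\<integral>\<^sup>+x. ennreal (- f x) \<partial>\<nu>2)"
    by (rule LIMSEQ_le[OF tendsto_add[OF lim(1)[of \<nu>2] lim(2)[of \<nu>1]]
          tendsto_add[OF lim(1)[of \<nu>1] lim(2)[of \<nu>2]]])
      (use dom in \<open>auto simp: dominates_def\<close>)
  then show ?thesis using fin unfolding dominates_def by blast
qed

lemma dominates_cong:
  assumes "dominates \<nu>1 \<nu>2 f" "\<And>x. x \<in> space \<nu>1 \<union> space \<nu>2 \<Longrightarrow> f x = g x"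
  shows "dominates \<nu>1 \<nu>2 g"
proof -
  have "(\<integral>\<^sup>+x. ennreal (f x) \<partial>\<nu>) = (\<integral>\<^sup>+x. ennreal (g x) \<partial>\<nu>)"
    "(\<integral>\<^sup>+x. ennreal (- f x) \<partial>\<nu>) = (\<integral>\<^sup>+x. ennreal (- g x) \<partial>\<nu>)" if "\<nu> = \<nu>1 \<or> \<nu> = \<nu>2" for \<nu>
    using assms(2) that by (auto intro!: nn_integral_cong)
  then show ?thesis using assms(1) unfolding dominates_def by simp
qed

lemma dominates_scale:
  assumes "dominates \<nu>1 \<nu>2 f" "0 \<le> c"
    and [measurable]: "f \<in> borel_measurable \<nu>1" "f \<in> borel_measurable \<nu>2"
  shows "dominates \<nu>1 \<nu>2 (\<lambda>x. c * f x)"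
proof -
  have m: "ennreal (c * y) = ennreal c * ennreal y" for y
    using assms(2) by (simp add: ennreal_mult')
  have n: "ennreal (- (c * y)) = ennreal c * ennreal (- y)" for y
    using m[of "- y"] by simp
  show ?thesis
    using assms(1) unfolding dominates_def m n
    by (simp add: nn_integral_cmult ennreal_mult_less_top mult_left_mono flip: distrib_left)
qed

section \<open>Approximation within the cone\<close>

text \<open>Conditions (i) to (iii) for a fixed pair of measures, detached from \<open>G\<close>. A
  polynomial of degree at most \<open>k - 1\<close> is first subtracted from a function of the cone,
  which calls for a finite integral of its positive part, and later added back, which calls for its
  inequality.\<close>

locale moment_comparison = gauge_interval +
  fixes n k :: nat and \<nu>1 \<nu>2 :: "real measure"
  assumes sets_\<nu>: "sets \<nu>1 = sets (restrict_space borel I)" "sets \<nu>2 = sets (restrict_space borel I)"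
    and k: "1 \<le> k" "k \<le> n + 1"
    and dominates_P_plus: "p \<in> P_plus I w k n \<Longrightarrow> dominates \<nu>1 \<nu>2 p"
    and dominates_pbasis_plus: "t \<in> I \<Longrightarrow> dominates \<nu>1 \<nu>2 (pbasis_plus I w t 0 n)"
    and dominates_wpoly: "p \<in> wpoly I w (k - 1) \<Longrightarrow> dominates \<nu>1 \<nu>2 p"
    and wpoly_finite: "p \<in> wpoly I w (k - 1) \<Longrightarrow> (\<integral>\<^sup>+x. ennreal (p x) \<partial>\<nu>1) < \<infinity>"
      "p \<in> wpoly I w (k - 1) \<Longrightarrow> (\<integral>\<^sup>+x. ennreal (p x) \<partial>\<nu>2) < \<infinity>"
begin

lemma space_\<nu>: "space \<nu>1 = I" "space \<nu>2 = I"
  using sets_eq_imp_space_eq[OF sets_\<nu>(1)] sets_eq_imp_space_eq[OF sets_\<nu>(2)]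
  by (simp_all add: space_restrict_space)

lemma measurable_\<nu>:
  assumes "f \<in> borel_measurable borel_I"
  shows "f \<in> borel_measurable \<nu>1" "f \<in> borel_measurable \<nu>2"
  using assms measurable_cong_sets[OF sets_\<nu>(1) refl] measurable_cong_sets[OF sets_\<nu>(2) refl]
  by auto

lemma lift_measurable:
  assumes "u \<in> borel_measurable borel_I"
  shows "lift u \<in> borel_measurable \<nu>1" "lift u \<in> borel_measurable \<nu>2"
  using measurable_\<nu>[OF borel_on_measurable[OF lift_borel_on[OF assms]]] .

text \<open>The truncated functions \<open>p\<^bsub>t;0,n\<^esub>\<^sup>+\<close> and their nonnegative combinations, recorded with
  all their derivatives.\<close>

definition generator :: "(nat \<Rightarrow> real \<Rightarrow> real) \<Rightarrow> bool" where
  "generator \<phi> \<longleftrightarrow>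
     (\<forall>j<n. primitive I (\<lambda>s. w (Suc j) s * \<phi> (Suc j) s) (\<phi> j)) \<and>
     (\<forall>j\<le>n. \<phi> j \<in> borel_measurable borel_I \<and> (\<forall>x\<in>I. 0 \<le> \<phi> j x)) \<and>
     (\<exists>y\<in>I. \<forall>j\<le>n. \<forall>x\<in>I. x \<le> y \<longrightarrow> \<phi> j x = 0) \<and>
     dominates \<nu>1 \<nu>2 (lift (\<phi> 0))"

lemma generator_zero: "generator (\<lambda>_ _. 0)"
proof -
  have "dominates \<nu>1 \<nu>2 (\<lambda>_. 0)" unfolding dominates_def by simp
  then have "dominates \<nu>1 \<nu>2 (lift (\<lambda>_. 0))"
    by (rule dominates_cong) (auto simp: space_\<nu> lift_def)
  then show ?thesis using nondeg primitive_const unfolding generator_def by auto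
qed

lemma generator_add_scale:
  assumes \<phi>: "generator \<phi>" and \<psi>: "generator \<psi>" and "0 \<le> c"
  shows "generator (\<lambda>j x. \<phi> j x + c * \<psi> j x)"
  unfolding generator_def
proof (intro conjI allI impI ballI)
  fix j assume "j < n"
  then have p: "primitive I (\<lambda>s. w (Suc j) s * \<phi> (Suc j) s) (\<phi> j)"
    "primitive I (\<lambda>s. w (Suc j) s * \<psi> (Suc j) s) (\<psi> j)"
    using \<phi> \<psi> unfolding generator_def by blast+
  show "primitive I (\<lambda>s. w (Suc j) s * (\<phi> (Suc j) s + c * \<psi> (Suc j) s)) (\<lambda>x. \<phi> j x + c * \<psi> j x)"
    by (rule primitive_cong[OF primitive_add[OF p(1) primitive_scale[OF p(2), of c]]])
      (simp_all add: algebra_simps)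
next
  fix j assume "j \<le> n"
  then have [measurable]: "\<phi> j \<in> borel_measurable borel_I" "\<psi> j \<in> borel_measurable borel_I"
    using \<phi> \<psi> unfolding generator_def by blast+
  show "(\<lambda>x. \<phi> j x + c * \<psi> j x) \<in> borel_measurable borel_I" by measurable
next
  fix j x assume "j \<le> n" "x \<in> I"
  then have "0 \<le> \<phi> j x" "0 \<le> \<psi> j x" using \<phi> \<psi> unfolding generator_def by blast+
  then show "0 \<le> \<phi> j x + c * \<psi> j x" using \<open>0 \<le> c\<close> by simp
next
  obtain y where y: "y \<in> I" "\<And>j x. j \<le> n \<Longrightarrow> x \<in> I \<Longrightarrow> x \<le> y \<Longrightarrow> \<phi> j x = 0"
    using \<phi> unfolding generator_def by blast
  obtain z where z: "z \<in> I" "\<And>j x. j \<le> n \<Longrightarrow> x \<in> I \<Longrightarrow> x \<le> z \<Longrightarrow> \<psi> j x = 0"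
    using \<psi> unfolding generator_def by blast
  show "\<exists>y\<in>I. \<forall>j\<le>n. \<forall>x\<in>I. x \<le> y \<longrightarrow> \<phi> j x + c * \<psi> j x = 0"
    by (rule bexI[of _ "min y z"]) (use y z in \<open>auto simp: min_def\<close>)
next
  have d: "dominates \<nu>1 \<nu>2 (lift (\<phi> 0))" "dominates \<nu>1 \<nu>2 (lift (\<psi> 0))"
    and m: "\<phi> 0 \<in> borel_measurable borel_I" "\<psi> 0 \<in> borel_measurable borel_I"
    using \<phi> \<psi> unfolding generator_def by blast+
  note lm = lift_measurable[OF m(1)] lift_measurable[OF m(2)]
  have "dominates \<nu>1 \<nu>2 (\<lambda>x. lift (\<phi> 0) x + c * lift (\<psi> 0) x)"
    by (rule dominates_add[OF d(1) dominates_scale[OF d(2) \<open>0 \<le> c\<close>]])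
      (use lm in \<open>auto intro: borel_measurable_times\<close>)
  then show "dominates \<nu>1 \<nu>2 (lift (\<lambda>x. \<phi> 0 x + c * \<psi> 0 x))"
    by (rule dominates_cong) (auto simp: space_\<nu> lift_def algebra_simps)
qed

text \<open>Entry \<open>d\<close> plays the role of the derivative of order \<open>n - d\<close> of
  a truncated function. Compared with \<open>pbasis\<close>, the leading gauge factor is moved under
  the next integral.\<close>

fun iterated_integral :: "real \<Rightarrow> real set \<Rightarrow> nat \<Rightarrow> real \<Rightarrow> real" where
  "iterated_integral t U 0 = indicator U"
| "iterated_integral t U (Suc d) =
     (\<lambda>x. LBINT s=ereal t..ereal x. w (n - d) s * iterated_integral t U d s)"

text \<open>The integral does not see whether the ray \<open>U\<close> contains its endpoint \<open>t\<close>, so an open ray gives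
  the same function as a closed one except for \<open>d = 0\<close>.\<close>

lemma iterated_integral:
  fixes t U
  assumes t: "t \<in> I" and U: "{x \<in> I. t < x} \<subseteq> U" "U \<subseteq> {x \<in> I. t \<le> x}" and "d \<le> n"
  defines "\<Psi> \<equiv> iterated_integral t U"
  shows "\<Psi> d \<in> borel_measurable borel_I"
    and "d < n \<Longrightarrow> primitive I (\<lambda>s. w (n - d) s * \<Psi> d s) (\<Psi> (Suc d))"
    and "x \<in> I \<Longrightarrow> 0 \<le> \<Psi> d x" and "x \<in> I \<Longrightarrow> x \<notin> U \<Longrightarrow> \<Psi> d x = 0"
    and "x \<in> I \<Longrightarrow> 0 < d \<or> x \<noteq> t \<or> t \<in> U \<Longrightarrow> w (n - d) x * \<Psi> d x = pbasis_plus I w t (n - d) n x"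
proof -
  have prim: "primitive I (\<lambda>s. w (n - d) s * \<Psi> d s) (\<Psi> (Suc d))"
    if \<Psi>: "\<Psi> d \<in> borel_measurable borel_I" "0 < d \<longrightarrow> continuous_on I (\<Psi> d)" for d
  proof -
    have "set_integrable lborel {z..x} (\<lambda>s. w (n - d) s * \<Psi> d s)" if zx: "z \<in> I" "x \<in> I" for z x
    proof (cases "0 < d")
      case True
      then show ?thesis using gauge_mult_continuous_integrable zx \<Psi> by blast
    next
      case False
      then show ?thesis
        by (intro gauge_mult_integrable[OF \<Psi>(1) zx, of 1]) (auto simp: \<Psi>_def indicator_def)
    qed
    from interval_integral_primitive[OF this t] show ?thesis by (simp add: \<Psi>_def)
  qed
  \<comment> \<open>Continuity for \<open>0 < d\<close> is carried along because it makes the next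
    integrand integrable; for \<open>d = 0\<close> the indicator is bounded.\<close>
  have *: "\<Psi> d \<in> borel_measurable borel_I \<and> (0 < d \<longrightarrow> continuous_on I (\<Psi> d)) \<and>
      (\<forall>x\<in>I. 0 \<le> \<Psi> d x) \<and> (\<forall>x\<in>I. x \<notin> U \<longrightarrow> \<Psi> d x = 0) \<and>
      (\<forall>x\<in>I. 0 < d \<or> x \<noteq> t \<or> t \<in> U \<longrightarrow> w (n - d) x * \<Psi> d x = pbasis_plus I w t (n - d) n x)"
    using \<open>d \<le> n\<close>
  proof (induction d)
    case 0
    have "U = {x \<in> I. t \<le> x} \<or> U = {x \<in> I. t < x}"
    proof (cases "t \<in> U")
      case True
      then show ?thesis using U by (intro disjI1 equalityI) (auto simp: le_less)
    next
      case False
      then show ?thesis using U by (intro disjI2 equalityI) (auto simp: le_less)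
    qed
    then have "\<exists>R\<in>sets borel. U = I \<inter> R"
      by (elim disjE; intro bexI[of _ "{t..}"] bexI[of _ "{t<..}"]) auto
    then have "U \<in> sets borel_I" by (auto simp: sets_restrict_space)
    then have "(indicator U :: real \<Rightarrow> real) \<in> borel_measurable borel_I" by simp
    moreover have "w n x * indicator U x = pbasis_plus I w t n n x"
      if "x \<in> I" "x \<noteq> t \<or> t \<in> U" for x
    proof -
      have "x \<in> U \<longleftrightarrow> t \<le> x" using that U by (auto simp: le_less)
      then show ?thesis using that(1) unfolding pbasis_plus_def by (simp add: pbasis.simps[of I w t n n])
    qed
    ultimately show ?case by (auto simp: \<Psi>_def)
  next
    case (Suc d)
    then have IH: "\<Psi> d \<in> borel_measurable borel_I" "0 < d \<longrightarrow> continuous_on I (\<Psi> d)"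
      "\<And>x. x \<in> I \<Longrightarrow> 0 \<le> \<Psi> d x" "\<And>x. x \<in> I \<Longrightarrow> x \<notin> U \<Longrightarrow> \<Psi> d x = 0"
      "\<And>x. x \<in> I \<Longrightarrow> x \<noteq> t \<Longrightarrow> w (n - d) x * \<Psi> d x = pbasis_plus I w t (n - d) n x"
      by auto
    note p = prim[OF IH(1,2)]
    have c: "continuous_on I (\<Psi> (Suc d))" by (rule primitive_continuous[OF p])
    have eq: "\<Psi> (Suc d) = (\<lambda>x. LBINT s=ereal t..ereal x. w (n - d) s * \<Psi> d s)"
      by (simp add: \<Psi>_def)
    have left: "\<Psi> (Suc d) x = 0" if "x \<in> I" "x \<le> t" for x
    proof (cases "x = t")
      case False
      then have "x < t" using that by simp
      have "w (n - d) s * \<Psi> d s = 0" if "s \<in> {x<..<t}" for s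
      proof -
        have "s \<notin> U" using U(2) that by auto
        moreover have "s \<in> I" using subsetD[OF atLeastAtMost_subset[OF \<open>x \<in> I\<close> t], of s] that by simp
        ultimately show ?thesis using IH(4) by simp
      qed
      then have "(LINT s:{x<..<t}|lborel. w (n - d) s * \<Psi> d s) = (LINT s:{x<..<t}|lborel. 0)"
        by (intro set_lebesgue_integral_cong) auto
      then show ?thesis using \<open>x < t\<close> unfolding eq by (simp add: interval_lebesgue_integral_def)
    qed (simp add: eq)
    have "mono_on I (\<Psi> (Suc d))"
      by (rule primitive_mono[OF p]) (use IH(3) less_imp_le[OF w_pos] in simp)
    then have nonneg: "0 \<le> \<Psi> (Suc d) x" if "x \<in> I" for x
      using mono_onD[of I "\<Psi> (Suc d)" t x] left[OF that] left[OF t] t that by (cases "x \<le> t") auto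
    have zero: "\<Psi> (Suc d) x = 0" if "x \<in> I" "x \<notin> U" for x
      using left[OF that(1)] that U by force
    have pb: "w (n - Suc d) x * \<Psi> (Suc d) x = pbasis_plus I w t (n - Suc d) n x" if x: "x \<in> I" for x
    proof (cases "t \<le> x")
      case True
      have S: "n - Suc d < n" "Suc (n - Suc d) = n - d" using Suc.prems by auto
      \<comment> \<open>The point \<open>t\<close> is left out: for \<open>d = 0\<close> and an open
        ray the identity fails there.\<close>
      have "w (n - d) s * \<Psi> d s = pbasis I w t (n - d) n s" if "s \<in> {t<..<x}" for s
      proof -
        have "s \<in> I" using subsetD[OF atLeastAtMost_subset[OF t x], of s] that by simp
        then show ?thesis using IH(5)[of s] that unfolding pbasis_plus_def by simp
      qed
      then have "(LINT s:{t<..<x}|lborel. w (n - d) s * \<Psi> d s) =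
          (LINT s:{t<..<x}|lborel. pbasis I w t (n - d) n s)"
        by (intro set_lebesgue_integral_cong) auto
      then have "\<Psi> (Suc d) x = (LBINT s=ereal t..ereal x. pbasis I w t (n - d) n s)"
        using True unfolding eq by (simp add: interval_lebesgue_integral_def)
      then show ?thesis
        using True x S unfolding pbasis_plus_def by (simp add: pbasis.simps[of I w t "n - Suc d" n])
    next
      case False
      then show ?thesis using left[OF x] x unfolding pbasis_plus_def by simp
    qed
    show ?case
      using continuous_borel_measurable[OF c] c nonneg zero pb by blast
  qed
  then show "\<Psi> d \<in> borel_measurable borel_I" "x \<in> I \<Longrightarrow> 0 \<le> \<Psi> d x"
    "x \<in> I \<Longrightarrow> x \<notin> U \<Longrightarrow> \<Psi> d x = 0"
    "x \<in> I \<Longrightarrow> 0 < d \<or> x \<noteq> t \<or> t \<in> U \<Longrightarrow> w (n - d) x * \<Psi> d x = pbasis_plus I w t (n - d) n x"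
    by blast+
  show "primitive I (\<lambda>s. w (n - d) s * \<Psi> d s) (\<Psi> (Suc d))"
    using prim * by blast
qed

text \<open>For \<open>n = 0\<close> monotone functions need not be right-continuous, so open rays occur as level
  sets but not in condition (iii).\<close>

lemma dominates_open_ray:
  assumes "n = 0" "t \<in> I" "u \<in> I" "t < u"
  shows "dominates \<nu>1 \<nu>2 (lift (indicator {x \<in> I. t < x}))"
proof (rule dominates_limit)
  \<comment> \<open>The closed rays from points decreasing to \<open>t\<close> exhaust the open ray;
    the point \<open>u\<close> keeps these points inside I.\<close>
  let ?t = "\<lambda>m. t + (u - t) / real (Suc m)"
  let ?s = "\<lambda>m. lift (indicator {x \<in> I. ?t m \<le> x})"
  have tI: "?t m \<in> I" and tt: "t < ?t m" for m
  proof -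
    have "(u - t) / real (Suc m) \<le> (u - t) / 1" using assms(4) by (intro divide_left_mono) auto
    moreover show "t < ?t m" using assms(4) by simp
    ultimately show "?t m \<in> I" using atLeastAtMost_subset[OF assms(2,3)] by auto
  qed
  show "dominates \<nu>1 \<nu>2 (?s m)" for m
  proof (rule dominates_cong[OF dominates_pbasis_plus[OF tI]])
    show "pbasis_plus I w (?t m) 0 n x = ?s m x" if "x \<in> space \<nu>1 \<union> space \<nu>2" for x
      using that assms(1) unfolding space_\<nu> pbasis_plus_def lift_def
      by (simp add: pbasis.simps[of I w _ 0 0] indicator_def)
  qed
  have "(indicator {x \<in> I. ?t m \<le> x} :: real \<Rightarrow> real) \<in> borel_measurable borel_I" for m
  proof -
    have "{x \<in> I. ?t m \<le> x} = I \<inter> {?t m..}" by auto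
    then have "{x \<in> I. ?t m \<le> x} \<in> sets borel_I" by (auto simp: sets_restrict_space)
    then show ?thesis by simp
  qed
  then show "?s m \<in> borel_measurable \<nu>1" "?s m \<in> borel_measurable \<nu>2" for m
    by (rule lift_measurable)+
  show "increases_to (\<lambda>m. ?s m x) (lift (indicator {x \<in> I. t < x}) x) \<or>
      increases_to (\<lambda>m. - ?s m x) (- lift (indicator {x \<in> I. t < x}) x)"
    if "x \<in> space \<nu>1 \<union> space \<nu>2" for x
  proof -
    have x: "x \<in> I" using that by (simp add: space_\<nu>)
    have "increases_to (\<lambda>m. indicator {x \<in> I. ?t m \<le> x} x) (indicator {x \<in> I. t < x} x)"
      unfolding increases_to_def
    proof (intro conjI allI)
      show "incseq (\<lambda>m. indicator {x \<in> I. ?t m \<le> x} x :: real)"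
      proof (rule incseq_SucI)
        fix m
        have "?t (Suc m) \<le> ?t m" using assms(4) by (auto intro!: divide_left_mono)
        then show "indicator {x \<in> I. ?t m \<le> x} x \<le> (indicator {x \<in> I. ?t (Suc m) \<le> x} x :: real)"
          using order_trans[of "?t (Suc m)" "?t m" x] by (simp add: indicator_def)
      qed
      show "(\<lambda>m. indicator {x \<in> I. ?t m \<le> x} x) \<longlonglongrightarrow> (indicator {x \<in> I. t < x} x :: real)"
      proof (cases "t < x")
        case True
        have "?t \<longlonglongrightarrow> t + 0"
          by (intro tendsto_add tendsto_const)
            (use LIMSEQ_Suc[OF lim_const_over_n[of "u - t"]] in simp)
        then have "\<forall>\<^sub>F m in sequentially. ?t m < x" using True by (intro order_tendstoD(2)) auto
        then have "\<forall>\<^sub>F m in sequentially.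
            indicator {x \<in> I. ?t m \<le> x} x = (indicator {x \<in> I. t < x} x :: real)"
          by (rule eventually_mono) (use True x in \<open>simp add: indicator_def\<close>)
        then show ?thesis by (rule tendsto_eventually)
      next
        case False
        then have "\<not> ?t m \<le> x" for m using tt[of m] by linarith
        then show ?thesis using False by (simp add: indicator_def)
      qed
    qed simp
    from increases_to_mult[OF this less_imp_le[OF w_pos[OF x, of 0]]]
    show ?thesis using x by (simp add: lift_def)
  qed
  have "(\<integral>\<^sup>+x. ennreal (- lift (indicator {x \<in> I. t < x}) x) \<partial>\<nu>) = (\<integral>\<^sup>+x. 0 \<partial>\<nu>)"
    if "space \<nu> = I" for \<nu>
    using that less_imp_le[OF w_pos, of _ 0]
    by (intro nn_integral_cong) (auto simp: lift_def ennreal_neg)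
  then show "(\<integral>\<^sup>+x. ennreal (- lift (indicator {x \<in> I. t < x}) x) \<partial>\<nu>1) < \<infinity>"
    "(\<integral>\<^sup>+x. ennreal (- lift (indicator {x \<in> I. t < x}) x) \<partial>\<nu>2) < \<infinity>"
    using space_\<nu> by simp_all
qed

text \<open>A proper nonempty upper set is a ray from its infimum. The outside point
  \<open>y\<close> bounds it from below and is a point up to which all entries vanish. The full
  interval is left to the constant term of a step function.\<close>

lemma generator_upset:
  assumes U: "U \<subseteq> I" "\<And>x y. x \<in> U \<Longrightarrow> y \<in> I \<Longrightarrow> x \<le> y \<Longrightarrow> y \<in> U" and "u \<in> U" "y \<in> I" "y \<notin> U"
  obtains \<phi> where "generator \<phi>" "\<phi> n = indicator U"
proof
  define t where "t = Inf U"
  have low: "y \<le> v" if "v \<in> U" for v using U(2)[OF that \<open>y \<in> I\<close>] \<open>y \<notin> U\<close> by force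
  then have bdd: "bdd_below U" by (auto simp: bdd_below_def)
  have "y \<le> t" unfolding t_def using \<open>u \<in> U\<close> low by (intro cInf_greatest) auto
  moreover have tu: "t \<le> v" if "v \<in> U" for v unfolding t_def by (rule cInf_lower[OF that bdd])
  ultimately have t: "t \<in> I"
    using subsetD[OF atLeastAtMost_subset[OF \<open>y \<in> I\<close> subsetD[OF U(1) \<open>u \<in> U\<close>]], of t]
      tu[OF \<open>u \<in> U\<close>] by simp
  have ray: "{x \<in> I. t < x} \<subseteq> U" "U \<subseteq> {x \<in> I. t \<le> x}"
  proof -
    show "{x \<in> I. t < x} \<subseteq> U"
    proof
      fix x assume "x \<in> {x \<in> I. t < x}"
      then obtain v where "v \<in> U" "v < x" using cInf_less_iff[of U x] \<open>u \<in> U\<close> bdd unfolding t_def by auto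
      then show "x \<in> U" using U(2) \<open>x \<in> {x \<in> I. t < x}\<close> by auto
    qed
  qed (use tu U(1) in auto)
  let ?\<phi> = "\<lambda>j. iterated_integral t U (n - j)"
  note it = iterated_integral[OF t ray]
  show "generator ?\<phi>"
    unfolding generator_def
  proof (intro conjI allI impI ballI bexI[of _ y])
    fix j assume "j < n"
    then have "n - Suc j < n" "Suc (n - Suc j) = n - j" "n - (n - Suc j) = Suc j" by auto
    then show "primitive I (\<lambda>s. w (Suc j) s * ?\<phi> (Suc j) s) (?\<phi> j)"
      using it(2)[of "n - Suc j"] by simp
  next
    show "?\<phi> j x = 0" if "j \<le> n" "x \<in> I" "x \<le> y" for j x
      using it(4)[of "n - j" x] U(2)[of x y] that \<open>y \<in> I\<close> \<open>y \<notin> U\<close> by auto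
  next
    have ind: "?\<phi> n = indicator U" by simp
    have pb: "dominates \<nu>1 \<nu>2 (lift (?\<phi> 0))" if "0 < n \<or> t \<in> U"
    proof (rule dominates_cong[OF dominates_pbasis_plus[OF t]])
      show "pbasis_plus I w t 0 n x = lift (?\<phi> 0) x" if "x \<in> space \<nu>1 \<union> space \<nu>2" for x
        using it(5)[of n x] that \<open>0 < n \<or> t \<in> U\<close> by (auto simp: space_\<nu> lift_def)
    qed
    show "dominates \<nu>1 \<nu>2 (lift (?\<phi> 0))"
    proof (cases "0 < n \<or> t \<in> U")
      \<comment> \<open>Here \<open>n = 0\<close> and the ray is open, so condition (iii) is reached
        through closed rays.\<close>
      case False
      then have "U = {x \<in> I. t < x}" using ray by force
      moreover have "t < u" using tu[OF \<open>u \<in> U\<close>] \<open>u \<in> U\<close> False by (cases "t = u") auto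
      ultimately have "dominates \<nu>1 \<nu>2 (lift (indicator U))"
        using dominates_open_ray[OF _ t, of u] U(1) \<open>u \<in> U\<close> False by auto
      moreover have "n - 0 = 0" using False by simp
      ultimately show ?thesis by (simp only: iterated_integral.simps(1))
    qed (rule pb)
  qed (use it(1,3) \<open>y \<in> I\<close> in simp_all)
  show "?\<phi> n = indicator U" by simp
qed

text \<open>Induction on the number of values. Lowering the largest value \<open>M\<close> to the
  second largest \<open>M'\<close> removes \<open>M - M'\<close> times the indicator of the top
  level set, which is an upper set by monotonicity and proper unless the function is
  constant.\<close>

lemma monotone_step_function:
  assumes "finite (s ` I)" "mono_on I s"
  shows "\<exists>c \<phi>. generator \<phi> \<and> (\<forall>x\<in>I. s x = c + \<phi> n x)"
  using assms
proof (induction "card (s ` I)" arbitrary: s rule: less_induct)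
  case less
  note fin = \<open>finite (s ` I)\<close> and mono = \<open>mono_on I s\<close>
  define M where "M = Max (s ` I)"
  have ne: "I \<noteq> {}" using nondeg by blast
  have M: "M \<in> s ` I" unfolding M_def by (rule Max_in) (use fin ne in auto)
  have leM: "s x \<le> M" if "x \<in> I" for x unfolding M_def using fin that by simp
  show ?case
  proof (cases "\<forall>x\<in>I. s x = M")
    case True
    then show ?thesis using generator_zero by (intro exI[of _ M] exI[of _ "\<lambda>_ _. 0"]) simp
  next
    case False
    then obtain y where y: "y \<in> I" "s y \<noteq> M" by blast
    define M' where "M' = Max (s ` I - {M})"
    have M': "M' \<in> s ` I - {M}" unfolding M'_def by (rule Max_in) (use fin y in auto)
    have leM': "s x \<le> M'" if "x \<in> I" "s x \<noteq> M" for x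
      unfolding M'_def by (rule Max_ge) (use fin that in auto)
    have MM': "M' < M" using M' leM by force
    let ?s = "\<lambda>x. min (s x) M'"
    have sub: "?s ` I \<subseteq> s ` I - {M}"
    proof (rule image_subsetI)
      fix x assume "x \<in> I"
      then show "?s x \<in> s ` I - {M}"
        using M' MM' leM'[of x] by (cases "s x = M") (auto simp: min_absorb1 min_absorb2)
    qed
    have "card (?s ` I) < card (s ` I)"
      by (rule psubset_card_mono[OF fin]) (use sub M in blast)
    moreover have "finite (?s ` I)" using sub fin by (rule finite_subset[OF _ finite_Diff])
    moreover have "mono_on I ?s" using mono by (auto intro!: mono_onI min.mono dest: mono_onD)
    ultimately obtain c \<phi> where \<phi>: "generator \<phi>" "\<And>x. x \<in> I \<Longrightarrow> ?s x = c + \<phi> n x"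
      using less(1) by blast
    let ?U = "{x \<in> I. s x = M}"
    obtain u where u: "u \<in> ?U" using M by blast
    have "y \<notin> ?U" using y by simp
    have up: "v \<in> ?U" if "x \<in> ?U" "v \<in> I" "x \<le> v" for x v
      using mono_onD[OF mono, of x v] leM[of v] that by auto
    obtain \<psi> where \<psi>: "generator \<psi>" "\<psi> n = indicator ?U"
      by (rule generator_upset[OF _ up u \<open>y \<in> I\<close> \<open>y \<notin> ?U\<close>]) auto
    have "s x = c + (\<phi> n x + (M - M') * \<psi> n x)" if "x \<in> I" for x
      using \<phi>(2)[OF that] leM'[OF that] MM' that unfolding \<psi>(2)
      by (cases "s x = M") (auto simp: indicator_def)
    moreover have "generator (\<lambda>j x. \<phi> j x + (M - M') * \<psi> j x)"
      by (rule generator_add_scale[OF \<phi>(1) \<psi>(1)]) (use MM' in simp)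
    ultimately show ?thesis by blast
  qed
qed

text \<open>The form of the approximants at level \<open>j\<close>. Both summands keep all their
  entries from \<open>j\<close> on; signs are imposed from level \<open>k\<close> on, which for
  \<open>j = 0\<close> puts the polynomial part into \<open>P_plus\<close>.\<close>

definition decomposable :: "nat \<Rightarrow> (real \<Rightarrow> real) \<Rightarrow> bool" where
  "decomposable j v \<longleftrightarrow> (\<exists>\<phi> P. generator \<phi> \<and> chain_from j n P \<and>
     (\<forall>i x. k \<le> i \<and> j \<le> i \<and> i \<le> n \<and> x \<in> I \<longrightarrow> 0 \<le> P i x) \<and> (\<forall>x\<in>I. v x = P j x + \<phi> j x))"

lemma chain_from_const: "chain_from N N (\<lambda>i. if i = N then (\<lambda>_. c) else (\<lambda>_. 0))"
  unfolding chain_from_def by (auto simp: primitive_const)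

lemma decomposable_top:
  assumes "finite (s ` I)" "mono_on I s" and nonneg: "\<And>x. k \<le> n \<Longrightarrow> x \<in> I \<Longrightarrow> 0 \<le> s x"
  shows "decomposable n s"
proof -
  obtain c \<phi> where \<phi>: "generator \<phi>" "\<And>x. x \<in> I \<Longrightarrow> s x = c + \<phi> n x"
    using monotone_step_function[OF assms(1,2)] by blast
  \<comment> \<open>Where the generator vanishes, \<open>s\<close> equals \<open>c\<close>, so
    \<open>c\<close> inherits the sign of \<open>s\<close>.\<close>
  obtain y where y: "y \<in> I" "\<phi> n y = 0" using \<phi>(1) unfolding generator_def by blast
  have "0 \<le> c" if "k \<le> n" using nonneg[OF that y(1)] \<phi>(2)[OF y(1)] y(2) by simp
  then show ?thesis
    unfolding decomposable_def using \<phi> chain_from_const[of n c]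
    by - (rule exI[of _ \<phi>], rule exI[of _ "\<lambda>i. if i = n then (\<lambda>_. c) else (\<lambda>_. 0)"], auto)
qed

text \<open>The generator already contains its own primitive as entry \<open>j\<close>; the rest
  \<open>v' - \<phi> j\<close> extends the chain and absorbs the initial value. For
  \<open>k \<le> j\<close> this rest is nondecreasing and agrees with the nonnegative
  \<open>v'\<close> up to some point, so it is nonnegative throughout.\<close>

lemma decomposable_primitive:
  assumes v: "decomposable (Suc j) v" and "j < n"
    and p: "primitive I (\<lambda>s. w (Suc j) s * v s) v'"
    and nonneg: "\<And>x. k \<le> j \<Longrightarrow> x \<in> I \<Longrightarrow> 0 \<le> v' x"
  shows "decomposable j v'"
proof -
  obtain \<phi> P where \<phi>: "generator \<phi>" and P: "chain_from (Suc j) n P"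
    and P0: "\<And>i x. k \<le> i \<Longrightarrow> Suc j \<le> i \<Longrightarrow> i \<le> n \<Longrightarrow> x \<in> I \<Longrightarrow> 0 \<le> P i x"
    and eq: "\<And>x. x \<in> I \<Longrightarrow> v x = P (Suc j) x + \<phi> (Suc j) x"
    using v unfolding decomposable_def by blast
  let ?q = "\<lambda>x. v' x - \<phi> j x"
  have "primitive I (\<lambda>s. w (Suc j) s * \<phi> (Suc j) s) (\<phi> j)"
    using \<phi> \<open>j < n\<close> unfolding generator_def by blast
  from primitive_diff[OF p this] have q: "primitive I (\<lambda>s. w (Suc j) s * P (Suc j) s) ?q"
    by (rule primitive_cong) (simp_all add: eq algebra_simps)
  have q0: "0 \<le> ?q x" if "k \<le> j" and x: "x \<in> I" for x
  proof -
    obtain y where y: "y \<in> I" "\<And>x. x \<in> I \<Longrightarrow> x \<le> y \<Longrightarrow> \<phi> j x = 0"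
      using \<phi> \<open>j < n\<close> unfolding generator_def by (meson less_imp_le)
    have mono: "mono_on I ?q"
      by (rule primitive_mono[OF q]) (use P0[of "Suc j"] \<open>k \<le> j\<close> \<open>j < n\<close> less_imp_le[OF w_pos] in simp)
    have "min x y \<in> I" using x y(1) by (simp add: min_def)
    then have "0 \<le> ?q (min x y)" using y(2)[of "min x y"] nonneg[OF \<open>k \<le> j\<close>] by simp
    also have "\<dots> \<le> ?q x" by (rule mono_onD[OF mono \<open>min x y \<in> I\<close> x]) simp
    finally show ?thesis .
  qed
  show ?thesis
    unfolding decomposable_def
  proof (rule exI[of _ \<phi>], rule exI[of _ "P(j := ?q)"], intro conjI)
    show "chain_from j n (P(j := ?q))" using chain_from_update[OF P _ q] \<open>j < n\<close> by simp
    show "\<forall>i x. k \<le> i \<and> j \<le> i \<and> i \<le> n \<and> x \<in> I \<longrightarrow> 0 \<le> (P(j := ?q)) i x"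
      using P0 q0 by auto
  qed (use \<phi> in auto)
qed

lemma decomposable_measurable:
  assumes "decomposable j v" "j \<le> n"
  shows "v \<in> borel_measurable borel_I"
proof -
  obtain \<phi> P where \<phi>: "generator \<phi>" and P: "chain_from j n P"
    and eq: "\<And>x. x \<in> I \<Longrightarrow> v x = P j x + \<phi> j x"
    using assms(1) unfolding decomposable_def by blast
  have [measurable]: "P j \<in> borel_measurable borel_I"
    by (rule continuous_borel_measurable[OF chain_from_continuous[OF P]]) simp
  have [measurable]: "\<phi> j \<in> borel_measurable borel_I" using \<phi> assms(2) unfolding generator_def by blast
  have "(\<lambda>x. P j x + \<phi> j x) \<in> borel_measurable borel_I" by measurable
  then show ?thesis by (rule borel_measurable_cong_on) (simp add: eq)
qed

lemma dominates_lift_add: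
  assumes "dominates \<nu>1 \<nu>2 (lift u)" "dominates \<nu>1 \<nu>2 (lift v)"
    and "u \<in> borel_measurable borel_I" "v \<in> borel_measurable borel_I"
    and "\<And>x. x \<in> I \<Longrightarrow> f x = u x + v x"
  shows "dominates \<nu>1 \<nu>2 (lift f)"
  by (rule dominates_cong[OF dominates_add[OF assms(1,2)]])
    (use assms(3-5) lift_measurable in \<open>auto simp: space_\<nu> lift_def distrib_left\<close>)

lemma decomposable_dominates:
  assumes "decomposable 0 v"
  shows "dominates \<nu>1 \<nu>2 (lift v)"
proof -
  obtain \<phi> P where \<phi>: "generator \<phi>" and P: "chain_from 0 n P"
    and P0: "\<And>i x. k \<le> i \<Longrightarrow> i \<le> n \<Longrightarrow> x \<in> I \<Longrightarrow> 0 \<le> P i x"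
    and eq: "\<And>x. x \<in> I \<Longrightarrow> v x = P 0 x + \<phi> 0 x"
    using assms unfolding decomposable_def by blast
  have "lift (P 0) \<in> P_plus I w k n" by (rule chain_P_plus[OF P k(1) P0])
  moreover have "dominates \<nu>1 \<nu>2 (lift (\<phi> 0))" "\<phi> 0 \<in> borel_measurable borel_I"
    using \<phi> unfolding generator_def by blast+
  moreover have "P 0 \<in> borel_measurable borel_I"
    by (rule continuous_borel_measurable[OF chain_from_continuous[OF P]]) simp
  ultimately show ?thesis using dominates_lift_add dominates_P_plus eq by blast
qed

lemma rational_toward_composition:
  assumes "mono_on I h"
  shows "finite ((\<lambda>x. rational_toward m (h x)) ` I)" "mono_on I (\<lambda>x. rational_toward m (h x))"
proof -
  show "finite ((\<lambda>x. rational_toward m (h x)) ` I)"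
    by (rule finite_subset[OF _ rational_toward_finite[of m]]) auto
  show "mono_on I (\<lambda>x. rational_toward m (h x))"
    using assms monoD[OF rational_toward_mono] by (auto intro!: mono_onI dest: mono_onD)
qed

section \<open>Approximation of a fixed function of the cone\<close>

context
  fixes f
  assumes f: "f \<in> F_plus I w k n"
begin

lemma F_plus_S_space: "f \<in> S_space I w n"
  using f unfolding F_plus_def by blast

lemma F_plus_mono: "k - 1 \<le> j \<Longrightarrow> j \<le> n \<Longrightarrow> mono_on I (wderiv I w j f)"
  using f unfolding F_plus_def by simp

text \<open>Downward induction from \<open>n\<close>. Down to level \<open>k\<close> the derivatives
  are nonnegative, which allows integration from the left end; the primitives obtained are again
  nonnegative, as \<open>decomposable_primitive\<close> asks.\<close>

lemma upper_derivative_approx: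
  assumes "k \<le> j" "j \<le> n"
  shows "\<exists>s. (\<forall>m. decomposable j (s m)) \<and>
    (\<forall>x\<in>I. increases_to (\<lambda>m. s m x) (wderiv I w j f x))"
  using assms(2,1)
proof (induction rule: inc_induct)
  case base
  let ?h = "wderiv I w n f"
  have h0: "0 \<le> ?h x" if "x \<in> I" for x using F_plus_nonneg[OF f k(1) base order_refl that] .
  note inc = rational_toward_increases_to(1)[OF h0]
  have "decomposable n (\<lambda>x. rational_toward m (?h x))" for m
    by (rule decomposable_top[OF rational_toward_composition[OF F_plus_mono]])
      (use increases_to_le(1)[OF inc] base in auto)
  then show ?case using inc by (intro exI[of _ "\<lambda>m x. rational_toward m (?h x)"]) blast
next
  case (step j)
  then obtain s where s: "\<And>m. decomposable (Suc j) (s m)"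
    "\<And>x. x \<in> I \<Longrightarrow> increases_to (\<lambda>m. s m x) (wderiv I w (Suc j) f x)" by auto
  have [measurable]: "s m \<in> borel_measurable borel_I" for m
    by (rule decomposable_measurable[OF s(1)]) (use step in simp)
  have [measurable]: "wderiv I w (Suc j) f \<in> borel_measurable borel_I"
    by (rule wderiv_measurable[OF F_plus_S_space]) (use step in simp)
  obtain u where u: "\<And>m. primitive I (\<lambda>x. w (Suc j) x * s m x) (u m)"
    "\<And>x. x \<in> I \<Longrightarrow> increases_to (\<lambda>m. u m x) (wderiv I w j f x)"
  proof (rule primitive_approx_left[OF wderiv_primitive(1)[OF F_plus_S_space step(2)]])
    show "0 \<le> wderiv I w j f x" if "x \<in> I" for x
      using F_plus_nonneg[OF f k(1) _ _ that, of j] step by simp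
    show "(\<lambda>x. w (Suc j) x * s m x) \<in> borel_measurable borel_I" for m by measurable
    show "(\<lambda>s. w (Suc j) s * wderiv I w (Suc j) f s) \<in> borel_measurable borel_I" by measurable
    show "increases_to (\<lambda>m. w (Suc j) x * s m x) (w (Suc j) x * wderiv I w (Suc j) f x)"
      if "x \<in> I" for x
      by (rule increases_to_mult[OF s(2)[OF that] less_imp_le[OF w_pos[OF that]]])
  qed (use that in blast)
  have "decomposable j (u m)" for m
    by (rule decomposable_primitive[OF s(1) step(2) u(1)]) (rule increases_to_le(1)[OF u(2)])
  then show ?case using u(2) by blast
qed

text \<open>Below level \<open>k\<close> the integrals start from a fixed point \<open>c\<close>: the derivative splits into a
  Taylor polynomial \<open>q\<close> at \<open>c\<close> and a remainder \<open>r\<close> of constant sign on each side of \<open>c\<close>.\<close>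

definition splits :: "real \<Rightarrow> nat \<Rightarrow> (nat \<Rightarrow> real \<Rightarrow> real) \<Rightarrow> (real \<Rightarrow> real) \<Rightarrow> (nat \<Rightarrow> real \<Rightarrow> real) \<Rightarrow>
    real \<Rightarrow> bool" where
  "splits c j s r q \<sigma> \<longleftrightarrow> \<bar>\<sigma>\<bar> = 1 \<and> (\<forall>m. decomposable j (s m)) \<and> chain_from j (k - 1) q \<and>
     (\<forall>x\<in>I. wderiv I w j f x = q j x + r x) \<and>
     (\<forall>x\<in>I. c \<le> x \<longrightarrow> increases_to (\<lambda>m. s m x) (r x)) \<and>
     (\<forall>x\<in>I. x < c \<longrightarrow> increases_to (\<lambda>m. \<sigma> * s m x) (\<sigma> * r x))"

text \<open>Integration from \<open>c\<close> turns \<open>\<sigma>\<close> into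
  \<open>- \<sigma>\<close>, and the new entry of \<open>q\<close> is the derivative minus the
  primitive of the remainder. Since \<open>j < k\<close>, decomposability carries no sign condition
  at this level.\<close>

lemma splits_primitive:
  assumes "c \<in> I" "\<bar>\<sigma>\<bar> = 1" and j: "j < n" "j \<le> k - 1"
    and s: "\<And>m. decomposable (Suc j) (s m)"
    and q: "chain_from (Suc j) (k - 1) q"
    and eq: "\<And>x. x \<in> I \<Longrightarrow> wderiv I w (Suc j) f x = q (Suc j) x + r x"
    and right: "\<And>x. x \<in> I \<Longrightarrow> c \<le> x \<Longrightarrow> increases_to (\<lambda>m. s m x) (r x)"
    and left: "\<And>x. x \<in> I \<Longrightarrow> x < c \<Longrightarrow> increases_to (\<lambda>m. \<sigma> * s m x) (\<sigma> * r x)"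
  shows "\<exists>s r q \<sigma>. splits c j s r q \<sigma>"
proof -
  let ?w = "w (Suc j)"
  note F = wderiv_primitive(1)[OF F_plus_S_space j(1)]
  have [measurable]: "s m \<in> borel_measurable borel_I" for m
    by (rule decomposable_measurable[OF s]) (use j in simp)
  have int: "set_integrable lborel {z..x} (\<lambda>t. ?w t * r t)" if "z \<in> I" "x \<in> I" for z x
  proof -
    have "set_integrable lborel {z..x} (\<lambda>t. ?w t * wderiv I w (Suc j) f t - ?w t * q (Suc j) t)"
      by (rule set_integral_diff(1)[OF primitive_integrable[OF F that(2,1)]
            gauge_mult_continuous_integrable[OF chain_from_continuous[OF q order_refl] that]])
    moreover have "?w t * wderiv I w (Suc j) f t - ?w t * q (Suc j) t = ?w t * r t"
      if "t \<in> {z..x}" for t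
      using eq[of t] subsetD[OF atLeastAtMost_subset[OF \<open>z \<in> I\<close> \<open>x \<in> I\<close>] that]
      by (simp add: algebra_simps)
    ultimately show ?thesis
      using set_integrable_cong[OF refl refl, of "{z..x}"] by (metis (no_types, lifting))
  qed
  have meas: "(\<lambda>t. ?w t * s m t) \<in> borel_measurable borel_I" for m by measurable
  have R: "increases_to (\<lambda>m. ?w x * s m x) (?w x * r x)" if "x \<in> I" "c \<le> x" for x
    by (rule increases_to_mult[OF right[OF that] less_imp_le[OF w_pos[OF that(1)]]])
  have L: "increases_to (\<lambda>m. \<sigma> * (?w x * s m x)) (\<sigma> * (?w x * r x))" if "x \<in> I" "x < c" for x
    using increases_to_mult[OF left[OF that] less_imp_le[OF w_pos[OF that(1), of "Suc j"]]]
    by (simp add: ac_simps)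
  obtain v u where vu: "primitive I (\<lambda>t. ?w t * r t) v" "\<And>m. primitive I (\<lambda>t. ?w t * s m t) (u m)"
    "\<And>x. x \<in> I \<Longrightarrow> c \<le> x \<Longrightarrow> increases_to (\<lambda>m. u m x) (v x)"
    "\<And>x. x \<in> I \<Longrightarrow> x < c \<Longrightarrow> increases_to (\<lambda>m. - \<sigma> * u m x) (- \<sigma> * v x)"
  proof (rule primitive_approx_base[OF int \<open>c \<in> I\<close> meas \<open>\<bar>\<sigma>\<bar> = 1\<close> R L])
    fix v u
    assume "primitive I (\<lambda>t. ?w t * r t) v" "\<And>m. primitive I (\<lambda>t. ?w t * s m t) (u m)"
      "\<And>x. x \<in> I \<Longrightarrow> c \<le> x \<Longrightarrow> increases_to (\<lambda>m. u m x) (v x)"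
      "\<And>x. x \<in> I \<Longrightarrow> x < c \<Longrightarrow> increases_to (\<lambda>m. - \<sigma> * u m x) (- \<sigma> * v x)"
    then show thesis by (rule that)
  qed
  let ?q = "\<lambda>x. wderiv I w j f x - v x"
  have "primitive I (\<lambda>t. ?w t * q (Suc j) t) ?q"
    by (rule primitive_cong[OF primitive_diff[OF F vu(1)]])
      (simp_all add: eq algebra_simps del: wderiv.simps)
  then have "chain_from j (k - 1) (q(j := ?q))" by (rule chain_from_update[OF q j(2)])
  moreover have "decomposable j (u m)" for m
    by (rule decomposable_primitive[OF s j(1) vu(2)]) (use j k in simp)
  ultimately have "splits c j u v (q(j := ?q)) (- \<sigma>)"
    unfolding splits_def using vu(3,4) \<open>\<bar>\<sigma>\<bar> = 1\<close> by simp
  then show ?thesis by blast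
qed

lemma splits_base:
  assumes "c \<in> I"
  shows "\<exists>s r q \<sigma>. splits c (k - 1) s r q \<sigma>"
proof (cases "k \<le> n")
  case True
  then obtain s where s: "\<And>m. decomposable k (s m)"
    "\<And>x. x \<in> I \<Longrightarrow> increases_to (\<lambda>m. s m x) (wderiv I w k f x)"
    using upper_derivative_approx[of k] by auto
  have K: "Suc (k - 1) = k" using k by simp
  \<comment> \<open>At level \<open>k\<close> the polynomial is zero and the remainder is the whole
    derivative. It is nonnegative on both sides of \<open>c\<close>, so the sign before the first
    integration is 1.\<close>
  have "chain_from (Suc (k - 1)) (k - 1) (\<lambda>_ _. 0)"
    unfolding chain_from_def by (simp add: primitive_const)
  then show ?thesis
    by (rule splits_primitive[OF assms, of 1 "k - 1" s _ "wderiv I w k f", rotated 4])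
      (use s K True k in simp_all)
next
  \<comment> \<open>For \<open>k = n + 1\<close> the cone fixes the sign of no derivative.
    Subtracting the value at \<open>c\<close> from the nondecreasing top derivative creates one:
    nonpositive to the left of \<open>c\<close>, whence the sign \<open>- 1\<close>.\<close>
  case False
  then have kn: "k - 1 = n" using k by simp
  let ?h = "wderiv I w n f" and ?c = "wderiv I w n f c"
  let ?r = "\<lambda>x. ?h x - ?c"
  have h: "mono_on I ?h" using F_plus_mono kn by simp
  have r: "mono_on I ?r" using h by (auto intro!: mono_onI dest: mono_onD)
  have "decomposable n (\<lambda>x. rational_toward m (?r x))" for m
    by (rule decomposable_top[OF rational_toward_composition[OF r]]) (use False in simp)
  moreover have "increases_to (\<lambda>m. rational_toward m (?r x)) (?r x)" if "x \<in> I" "c \<le> x" for x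
    by (rule rational_toward_increases_to(1)) (use mono_onD[OF h assms that(1)] that in simp)
  moreover have "increases_to (\<lambda>m. - rational_toward m (?r x)) (- ?r x)" if "x \<in> I" "x < c" for x
    by (rule rational_toward_increases_to(2)) (use mono_onD[OF h that(1) assms] that in simp)
  ultimately have "splits c n (\<lambda>m x. rational_toward m (?r x)) ?r
      (\<lambda>i. if i = n then (\<lambda>_. ?c) else (\<lambda>_. 0)) (- 1)"
    unfolding splits_def kn using chain_from_const[of n ?c] by auto
  then show ?thesis unfolding kn by blast
qed

lemma splits_all:
  assumes "c \<in> I" "j \<le> k - 1"
  shows "\<exists>s r q \<sigma>. splits c j s r q \<sigma>"
  using assms(2)
proof (induction rule: inc_induct)
  case base
  show ?case by (rule splits_base[OF assms(1)])
next
  case (step j)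
  then obtain s r q \<sigma> where "splits c (Suc j) s r q \<sigma>" by blast
  then show ?case
    unfolding splits_def
    by (intro splits_primitive[OF assms(1), unfolded splits_def, of \<sigma> j s q r]) (use step k in auto)
qed

lemma F_plus_dominates:
  assumes fin: "(\<integral>\<^sup>+x. ennreal (- f x) \<partial>\<nu>1) < \<infinity>" "(\<integral>\<^sup>+x. ennreal (- f x) \<partial>\<nu>2) < \<infinity>"
  shows "dominates \<nu>1 \<nu>2 f"
proof -
  obtain c where "c \<in> I" using nondeg by blast
  then obtain s r q \<sigma> where *: "splits c 0 s r q \<sigma>" using splits_all[of c 0] by blast
  have \<sigma>: "\<sigma> = 1 \<or> \<sigma> = - 1" using * unfolding splits_def by (auto simp: abs_if split: if_splits)
  have q: "chain_from 0 (k - 1) q" and s: "\<And>m. decomposable 0 (s m)"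
    and eq: "\<And>x. x \<in> I \<Longrightarrow> wderiv I w 0 f x = q 0 x + r x"
    using * unfolding splits_def by blast+
  have inc: "increases_to (\<lambda>m. s m x) (r x) \<or> increases_to (\<lambda>m. - s m x) (- r x)" if "x \<in> I" for x
    using * \<sigma> that unfolding splits_def by (cases "c \<le> x") (auto simp: not_le)
  have fb: "f \<in> borel_on I" using S_space_antimono[OF F_plus_S_space, of 0] by simp
  have f0: "f = lift (wderiv I w 0 f)" using lift_wderiv_0[OF fb] by simp
  have qm: "q 0 \<in> borel_measurable borel_I"
    by (rule continuous_borel_measurable[OF chain_from_continuous[OF q]]) simp
  have fm: "wderiv I w 0 f \<in> borel_measurable borel_I" by (rule wderiv_measurable[OF F_plus_S_space]) simp
  have "(\<lambda>x. wderiv I w 0 f x - q 0 x) \<in> borel_measurable borel_I"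
    using fm qm by (rule borel_measurable_diff)
  then have rm: "r \<in> borel_measurable borel_I"
    by (rule borel_measurable_cong_on) (use eq in simp)
  have sm: "s m \<in> borel_measurable borel_I" for m by (rule decomposable_measurable[OF s]) simp
  have qw: "lift (q 0) \<in> wpoly I w (k - 1)" by (rule chain_wpoly[OF q])
  have "(\<integral>\<^sup>+x. ennreal (- lift r x) \<partial>\<nu>) < \<infinity>"
    if "space \<nu> = I" "f \<in> borel_measurable \<nu>" "lift (q 0) \<in> borel_measurable \<nu>"
      "(\<integral>\<^sup>+x. ennreal (- f x) \<partial>\<nu>) < \<infinity>" "(\<integral>\<^sup>+x. ennreal (lift (q 0) x) \<partial>\<nu>) < \<infinity>" for \<nu>
  proof -
    have [measurable]: "f \<in> borel_measurable \<nu>" "lift (q 0) \<in> borel_measurable \<nu>"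
      using that by blast+
    \<comment> \<open>The remainder is \<open>f\<close> minus the polynomial, so its negative part
      is at most the negative part of \<open>f\<close> plus the positive part of the
      polynomial.\<close>
    have "- lift r x = - (f x + - lift (q 0) x)" if "x \<in> I" for x
      using eq[OF that] that fun_cong[OF f0, of x] by (simp add: lift_def algebra_simps del: wderiv.simps)
    then have "(\<integral>\<^sup>+x. ennreal (- lift r x) \<partial>\<nu>) \<le>
        (\<integral>\<^sup>+x. ennreal (- f x) + ennreal (lift (q 0) x) \<partial>\<nu>)"
      using ennreal_neg_add_le[of "f _" "- lift (q 0) _"] \<open>space \<nu> = I\<close>
      by (intro nn_integral_mono) (simp only: minus_minus)
    also have "\<dots> = (\<integral>\<^sup>+x. ennreal (- f x) \<partial>\<nu>) + (\<integral>\<^sup>+x. ennreal (lift (q 0) x) \<partial>\<nu>)"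
      by (rule nn_integral_add) measurable
    also have "\<dots> < \<infinity>" using that by simp
    finally show ?thesis .
  qed
  note finr = this[OF space_\<nu>(1) measurable_\<nu>(1)[OF borel_on_measurable[OF fb]] lift_measurable(1)[OF qm]
      fin(1) wpoly_finite(1)[OF qw]]
    this[OF space_\<nu>(2) measurable_\<nu>(2)[OF borel_on_measurable[OF fb]] lift_measurable(2)[OF qm]
      fin(2) wpoly_finite(2)[OF qw]]
  have "dominates \<nu>1 \<nu>2 (lift r)"
  proof (rule dominates_limit[OF decomposable_dominates[OF s] lift_measurable[OF sm] _ finr])
    fix x assume "x \<in> space \<nu>1 \<union> space \<nu>2"
    then have x: "x \<in> I" by (simp add: space_\<nu>)
    show "increases_to (\<lambda>m. lift (s m) x) (lift r x) \<or> increases_to (\<lambda>m. - lift (s m) x) (- lift r x)"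
      using inc[OF x] increases_to_mult[OF _ less_imp_le[OF w_pos[OF x, of 0]], of "\<lambda>m. s m x" "r x"]
        increases_to_mult[OF _ less_imp_le[OF w_pos[OF x, of 0]], of "\<lambda>m. - s m x" "- r x"] x
      by (auto simp: lift_def)
  qed
  then have "dominates \<nu>1 \<nu>2 (lift (wderiv I w 0 f))"
    by (rule dominates_lift_add[OF dominates_wpoly[OF qw] _ qm rm eq])
  then show ?thesis using f0 by simp
qed

end

end

section \<open>The equivalence for an intermediate set of test functions\<close>

theorem theorem5p3:
  fixes I :: "real set" and w :: "nat \<Rightarrow> real \<Rightarrow> real" and k n :: nat
    and G :: "(real \<Rightarrow> real) set" and \<nu>1 \<nu>2 :: "real measure"
  assumes "is_interval I" and "\<exists>x\<in>I. \<exists>y\<in>I. x < y"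
    and "gauge_sequence I w"
    and "1 \<le> k" and "k \<le> n + 1"
    and "P_plus I w k n \<union> pbasis_plus_set I w n \<subseteq> G" and "G \<subseteq> F_plus I w k n"
    and "(\<nu>1, \<nu>2) \<in> measures_bounded_below I G \<times> measures_bounded_below I G"
  shows "(\<nu>1, \<nu>2) \<in> dual_cone I G \<longleftrightarrow>
    (\<forall>p\<in>wpoly I w (k - 1). has_ext_integral \<nu>1 p \<and> has_ext_integral \<nu>2 p \<and>
        ext_integral \<nu>1 p = ext_integral \<nu>2 p \<and> ext_integral \<nu>1 p \<in> range ereal) \<and>
    (\<forall>p\<in>P_plus I w k n. ext_integral_ge \<nu>1 \<nu>2 p) \<and>
    (\<forall>t\<in>I. ext_integral_ge \<nu>1 \<nu>2 (pbasis_plus I w t 0 n))"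
    (is "_ \<longleftrightarrow> ?i \<and> ?ii \<and> ?iii")
proof -
  interpret gauge_interval I w
    by unfold_locales (use assms(1-3) in auto)
  have G: "P_plus I w k n \<subseteq> G" "\<And>t. t \<in> I \<Longrightarrow> pbasis_plus I w t 0 n \<in> G"
    using assms(6) unfolding pbasis_plus_set_def by auto
  have \<nu>: "sets \<nu>1 = sets (restrict_space borel I)" "sets \<nu>2 = sets (restrict_space borel I)"
    and below: "\<And>f. f \<in> G \<Longrightarrow> has_ext_integral \<nu>1 f \<and> ext_integral \<nu>1 f > -\<infinity>"
      "\<And>f. f \<in> G \<Longrightarrow> has_ext_integral \<nu>2 f \<and> ext_integral \<nu>2 f > -\<infinity>"
    using assms(8) unfolding measures_bounded_below_def measures_on_def by auto
  have neg: "(\<integral>\<^sup>+x. ennreal (- f x) \<partial>\<nu>1) < \<infinity>" "(\<integral>\<^sup>+x. ennreal (- f x) \<partial>\<nu>2) < \<infinity>" if "f \<in> G" for f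
    using neg_part_finite below that by blast+
  show ?thesis
  proof
    assume "(\<nu>1, \<nu>2) \<in> dual_cone I G"
    then have ge: "ext_integral_ge \<nu>1 \<nu>2 f" if "f \<in> G" for f
      using that unfolding dual_cone_def by auto
    have ?i
    proof
      fix p assume p: "p \<in> wpoly I w (k - 1)"
      obtain P where P: "chain_from 0 (k - 1) P" "p = lift (P 0)" by (rule wpoly_chain[OF p])
      \<comment> \<open>The entries of order \<open>k\<close> and above vanish on I, so
        \<open>p\<close> and its negative both lie in \<open>P_plus\<close>. The two inequalities
        give equality, and the finite negative part of \<open>- p\<close> is the positive part of
        \<open>p\<close>.\<close>
      define Q where "Q = (\<lambda>i x. - P i x)"
      have PQ: "chain_from 0 n P" "chain_from 0 n Q"
        using P(1) assms(4,5) primitive_scale[of _ _ "- 1"] unfolding chain_from_def Q_def by fastforce+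
      have zero: "0 \<le> P i x" "0 \<le> Q i x" if "k \<le> i" "i \<le> n" "x \<in> I" for i x
        using chain_from_zero[OF P(1), of i x] that assms(4) unfolding Q_def by auto
      have "p \<in> G" using chain_P_plus[OF PQ(1) assms(4) zero(1)] G(1) P(2) by auto
      have m: "lift (Q 0) \<in> G" using chain_P_plus[OF PQ(2) assms(4) zero(2)] G(1) by auto
      have Q: "lift (Q 0) x = - p x" if "x \<in> I" for x
        using that unfolding P(2) Q_def lift_def by simp
      have sp: "space \<nu>1 = I" "space \<nu>2 = I"
        using sets_eq_imp_space_eq[OF \<nu>(1)] sets_eq_imp_space_eq[OF \<nu>(2)]
        by (simp_all add: space_restrict_space)
      have fin: "(\<integral>\<^sup>+x. ennreal (- p x) \<partial>\<nu>1) < \<infinity>" "(\<integral>\<^sup>+x. ennreal (- p x) \<partial>\<nu>2) < \<infinity>"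
        using neg[OF \<open>p \<in> G\<close>] .
      have "dominates \<nu>1 \<nu>2 (lift (Q 0))" using dominates_iff[OF neg[OF m]] ge[OF m] by simp
      then have d': "dominates \<nu>1 \<nu>2 (\<lambda>x. - p x)" by (rule dominates_cong) (auto simp: sp Q)
      have d: "dominates \<nu>1 \<nu>2 p" using dominates_iff[OF fin] ge[OF \<open>p \<in> G\<close>] by simp
      have fin': "(\<integral>\<^sup>+x. ennreal (p x) \<partial>\<nu>1) < \<infinity>" "(\<integral>\<^sup>+x. ennreal (p x) \<partial>\<nu>2) < \<infinity>"
        using d' unfolding dominates_def by simp_all
      have "ext_integral \<nu>1 p \<le> ext_integral \<nu>2 p"
        using d' fin fin' unfolding dominates_def ext_integral_def
        by (subst ennreal_diff_le_iff) (simp_all add: add.commute)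
      moreover have "ext_integral \<nu>1 p \<ge> ext_integral \<nu>2 p"
        using ge[OF \<open>p \<in> G\<close>] unfolding ext_integral_ge_def by simp
      moreover have "ext_integral \<nu>1 p \<in> range ereal"
        using fin(1) fin'(1) unfolding ext_integral_def
        by (cases "\<integral>\<^sup>+x. ennreal (p x) \<partial>\<nu>1" rule: ennreal_cases;
            cases "\<integral>\<^sup>+x. ennreal (- p x) \<partial>\<nu>1" rule: ennreal_cases) (auto simp: enn2ereal_ennreal)
      ultimately show "has_ext_integral \<nu>1 p \<and> has_ext_integral \<nu>2 p \<and>
          ext_integral \<nu>1 p = ext_integral \<nu>2 p \<and> ext_integral \<nu>1 p \<in> range ereal"
        using below \<open>p \<in> G\<close> by auto
    qed
    then show "?i \<and> ?ii \<and> ?iii" using ge G by blast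
  next
    assume R: "?i \<and> ?ii \<and> ?iii"
    \<comment> \<open>Membership in \<open>G\<close> makes the negative parts finite, so the
      inequality of extended integrals can be rewritten without subtraction.\<close>
    have dom: "dominates \<nu>1 \<nu>2 f" if "f \<in> G" "ext_integral_ge \<nu>1 \<nu>2 f" for f
      using dominates_iff[OF neg[OF that(1)]] that(2) by simp
    have fin: "(\<integral>\<^sup>+x. ennreal (p x) \<partial>\<nu>1) < \<infinity>" "(\<integral>\<^sup>+x. ennreal (p x) \<partial>\<nu>2) < \<infinity>"
      "(\<integral>\<^sup>+x. ennreal (- p x) \<partial>\<nu>1) < \<infinity>" "(\<integral>\<^sup>+x. ennreal (- p x) \<partial>\<nu>2) < \<infinity>"
      if "p \<in> wpoly I w (k - 1)" for p
      using ext_integral_finite_parts[of \<nu>1 p] ext_integral_finite_parts[of \<nu>2 p] R that by auto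
    interpret moment_comparison I w n k \<nu>1 \<nu>2
    proof
      show "dominates \<nu>1 \<nu>2 p" if "p \<in> P_plus I w k n" for p
        using dom R G(1) that by blast
      show "dominates \<nu>1 \<nu>2 (pbasis_plus I w t 0 n)" if "t \<in> I" for t
        using dom R G(2) that by blast
      show "dominates \<nu>1 \<nu>2 p" if "p \<in> wpoly I w (k - 1)" for p
        using dominates_iff[OF fin(3,4)[OF that]] R that unfolding ext_integral_ge_def by auto
    qed (use assms(4,5) \<nu> fin in auto)
    have "ext_integral_ge \<nu>1 \<nu>2 f" if "f \<in> G" for f
      using F_plus_dominates[OF _ neg[OF that]] dominates_iff[OF neg[OF that]] assms(7) that by blast
    then show "(\<nu>1, \<nu>2) \<in> dual_cone I G" using assms(8) unfolding dual_cone_def by auto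
  qed
qed

end
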